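(* Let $n=2m$ be a positive even integer, $k=2^m$, let $\Gamma$ be a torsion-free discrete subgroup of $\mathrm{SO}^+(n,1)$, and let $\phi$ be an orientation preserving isometry of the hyperbolic space-form $\Gamma\backslash H^n$. Let $f\in\mathrm{SO}^+(n,1)$ be such that $f\Gamma f^{-1}=\Gamma$ and $\phi(\Gamma y)=\Gamma fy$ for all $y\in H^n$. Let $\hat\Gamma$ be a subgroup of $\mathrm{Spin}^+(n,1)$ such that the double covering $\mathrm{Ad}:\mathrm{Spin}^+(n,1)\to\mathrm{SO}^+(n,1)$ maps $\hat\Gamma$ isomorphically onto $\Gamma$, and let $\hat f\in\mathrm{Spin}^+(n,1)$ be such that $\mathrm{Ad}(\hat f)=f$. Suppose that $\hat f\hat\Gamma\hat f^{-1}=\hat\Gamma$ and that $\phi$ fixes the point $\Gamma x$ of $\Gamma\backslash H^n$. Let $\gamma$ be the element of $\Gamma$ such that $\gamma fx=x$, and let $\hat\gamma$ be the element of $\hat\Gamma$ such that $\mathrm{Ad}(\hat\gamma)=\gamma$. Let $\hat\phi$ be the vector bundle automorphism of the complex spinor bundle $\mu:\hat\Gamma\backslash\mathrm{Spin}^+(n,1)\times_{\Delta_n}\mathbb{C}^k\to\Gamma\backslash H^n$ induced by $\hat f$, and let $\hat\phi_x$ be the restriction of $\hat\phi$ to the fiber of $\mu$ over the point $\Gamma x$. Then $$\mathrm{tr}(\hat\phi_x)=\mathrm{tr}\big(\Delta_{n,1}(\hat\gamma\hat f)\big).$$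
   Context: $H^n=\{x\in\mathbb{R}^{n+1}:x_1^2+\cdots+x_n^2-x_{n+1}^2=-1,\ x_{n+1}>0\}$; $\mathrm{SO}^+(n,1)$ is the identity component of the special orthogonal group of $x_1^2+\cdots+x_n^2-x_{n+1}^2$, i.e. the orientation preserving isometry group of $H^n$. Clifford algebras use the convention $v^2=-q(v)1$. $\mathrm{C}\ell(n,1)$ is the real Clifford algebra of $q=x_1^2+\cdots+x_n^2-x_{n+1}^2$ on $\mathbb{R}^{n+1}$ with standard generators $e_1,\dots,e_{n+1}$, $\mathrm{C}\ell(n)$ is the subalgebra generated by $e_1,\dots,e_n$, and $\mathbb{C}\ell(n,1)$, $\mathbb{C}\ell(n)$ are the complexifications. $\mathrm{Spin}(n,1)$ is the group of products of an even number of vectors $v\in\mathbb{R}^{n+1}$ with $q(v)=\pm1$, $\mathrm{Spin}^+(n,1)$ is its identity component, and $\mathrm{Ad}(x)w=xwx^{-1}$. $\mathrm{Spin}(n)\subset\mathrm{C}\ell(n)$ is identified with the stabilizer of $e_{n+1}$ in $\mathrm{Spin}^+(n,1)$; write $S=\mathrm{Spin}(n)$. Complex spin representations: fix an isomorphism $\psi:\mathbb{C}\ell(n)\to\mathbb{C}(k)$ of complex algebras, $\mathbb{C}(k)$ being the $k\times k$ complex matrices. $\Delta_n:\mathrm{Spin}(n)\to\mathbb{C}(k)$ is the restriction of $\psi$. With $\omega=e_1\cdots e_n$, let $\rho^\pm:\mathbb{C}\ell(n,1)\to\mathbb{C}\ell(n)$ be the complex algebra homomorphism with $\rho^\pm(e_i)=e_i$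 for $i\le n$ and $\rho^\pm(e_{n+1})=\pm\mathbf{i}^m\omega$; $\Delta_{n,1}:\mathrm{Spin}^+(n,1)\to\mathbb{C}(k)$ is the restriction of $\psi\rho^\pm$ for some choice of sign (its trace does not depend on the choices), and it extends $\Delta_n$. The complex spinor bundle of $\Gamma\backslash H^n$ for the spin structure corresponding to $\hat\Gamma$ is $\hat\Gamma\backslash\mathrm{Spin}^+(n,1)\times_{\Delta_n}\mathbb{C}^k=\big((\hat\Gamma\backslash\mathrm{Spin}^+(n,1))\times\mathbb{C}^k\big)/S$, the quotient by the free right action $(\hat\Gamma g,v)s=(\hat\Gamma gs,\Delta_n(s)^{-1}v)$, with projection $\mu((\hat\Gamma g,v)S)=\Gamma(\mathrm{Ad}(g)e_{n+1})$. The automorphism induced by $\hat f$ is $\hat\phi((\hat\Gamma g,v)S)=(\hat\Gamma\hat fg,v)S$. *)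

theory Defs
  imports "HOL-Analysis.Analysis" "HOL-Algebra.Coset"
begin

type_synonym 'n lvec = "(real, 'n) vec"

type_synonym 'n lmat = "((real, 'n) vec, 'n) vec"

text \<open>
  The type variable \<open>'n\<close> is the ordered index set \<open>{1, ..., n+1}\<close>; its greatest element
  plays the role of \<open>n+1\<close>.
\<close>

abbreviation last_ix :: "'n::{finite,linorder}"
  where "last_ix \<equiv> Max UNIV"

abbreviation e_last :: "('n::{finite,linorder}) lvec"
  where "e_last \<equiv> axis last_ix 1"

section \<open>Hyperbolic space and its isometries\<close>

definition lor_sgn :: "'n::{finite,linorder} \<Rightarrow> 'a::comm_ring_1"
  where "lor_sgn i = (if i = last_ix then -1 else 1)"

definition lor_inner :: "('n::{finite,linorder}) lvec \<Rightarrow> 'n lvec \<Rightarrow> real"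
  where "lor_inner x y = (\<Sum>i\<in>UNIV. lor_sgn i * x $ i * y $ i)"

definition lor_q :: "('n::{finite,linorder}) lvec \<Rightarrow> real"
  where "lor_q x = (\<Sum>i\<in>UNIV. lor_sgn i * (x $ i)\<^sup>2)"

definition hyp_space :: "('n::{finite,linorder}) lvec set"
  where "hyp_space = {x. lor_q x = -1 \<and> x $ last_ix > 0}"

definition hyp_dist :: "('n::{finite,linorder}) lvec \<Rightarrow> 'n lvec \<Rightarrow> real"
  where "hyp_dist x y = arcosh (- lor_inner x y)"

definition SO_set :: "('n::{finite,linorder}) lmat set"
  where "SO_set = {A. (\<forall>x. lor_q (A *v x) = lor_q x) \<and> det A = 1}"

definition SO_plus :: "('n::{finite,linorder}) lmat monoid"
  where "SO_plus = \<lparr>carrier = connected_component_set SO_set (mat 1), mult = (**), one = mat 1\<rparr>"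

definition torsion_free :: "('g, 'b) monoid_scheme \<Rightarrow> 'g set \<Rightarrow> bool"
  where "torsion_free G H \<longleftrightarrow>
    (\<forall>h\<in>H. \<forall>j::nat. j > 0 \<longrightarrow> h [^]\<^bsub>G\<^esub> j = \<one>\<^bsub>G\<^esub> \<longrightarrow> h = \<one>\<^bsub>G\<^esub>)"

definition orb :: "('n::finite) lmat set \<Rightarrow> 'n lvec \<Rightarrow> 'n lvec set"
  where "orb \<Gamma> y = (\<lambda>A. A *v y) ` \<Gamma>"

definition space_form :: "'n lmat set \<Rightarrow> ('n::{finite,linorder}) lvec set set"
  where "space_form \<Gamma> = orb \<Gamma> ` hyp_space"

definition orb_dist :: "('n::{finite,linorder}) lvec set \<Rightarrow> 'n lvec set \<Rightarrow> real"
  where "orb_dist P Q = Inf {hyp_dist u v | u v. u \<in> P \<and> v \<in> Q}"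

text \<open>
  The orientation of the space-form is the one inherited from hyperbolic space, so an isometry
  preserves it iff it lifts, near every point, to an element of the orientation preserving
  isometry group of hyperbolic space.
\<close>

definition orientation_preserving_isometry ::
    "'n lmat set \<Rightarrow> (('n::{finite,linorder}) lvec set \<Rightarrow> 'n lvec set) \<Rightarrow> bool"
  where "orientation_preserving_isometry \<Gamma> \<phi> \<longleftrightarrow>
    bij_betw \<phi> (space_form \<Gamma>) (space_form \<Gamma>) \<and>
    (\<forall>P\<in>space_form \<Gamma>. \<forall>Q\<in>space_form \<Gamma>. orb_dist (\<phi> P) (\<phi> Q) = orb_dist P Q) \<and>
    (\<forall>x\<in>hyp_space. \<exists>U A. open U \<and> x \<in> U \<and> A \<in> carrier SO_plus \<and>
       (\<forall>y\<in>U \<inter> hyp_space. \<phi> (orb \<Gamma> y) = orb \<Gamma> (A *v y)))"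

section \<open>The Clifford algebra\<close>

text \<open>
  An element is given by its coefficients in the basis of products \<open>e\<^sub>I\<close>, in increasing order,
  of the generators \<open>e\<^sub>i\<close>, \<open>i \<in> I\<close>. The real Clifford algebra is the case of
  real coefficients, its complexification the case of complex coefficients.
\<close>

type_synonym ('a, 'n) clifford = "('a, 'n set) vec"

text \<open>
  Sorting \<open>e\<^sub>I e\<^sub>J\<close> costs a factor \<open>-1\<close> for each \<open>i \<in> I\<close>, \<open>j \<in> J\<close> with \<open>j < i\<close> and a factor
  \<open>e\<^sub>i\<^sup>2 = -q(e\<^sub>i)\<close> for each common index.
\<close>

definition cl_fac :: "'n::{finite,linorder} \<Rightarrow> 'n \<Rightarrow> 'a::comm_ring_1"
  where "cl_fac i j = (if j < i then -1 else if i = j then - lor_sgn i else 1)"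

definition cl_sign :: "'n::{finite,linorder} set \<Rightarrow> 'n set \<Rightarrow> 'a::comm_ring_1"
  where "cl_sign I J = (\<Prod>i\<in>I. \<Prod>j\<in>J. cl_fac i j)"

definition cl_mult :: "('a::comm_ring_1, 'n::{finite,linorder}) clifford \<Rightarrow>
    ('a, 'n) clifford \<Rightarrow> ('a, 'n) clifford"  (infixl \<open>\<star>\<close> 70)
  where "x \<star> y = (\<chi> K. \<Sum>(I, J) | sym_diff I J = K. cl_sign I J * x $ I * y $ J)"

definition cl_one :: "('a::comm_ring_1, 'n::{finite,linorder}) clifford"
  where "cl_one = axis {} 1"

definition cl_gen :: "'n::{finite,linorder} \<Rightarrow> ('a::comm_ring_1, 'n) clifford"
  where "cl_gen i = axis {i} 1"

definition cl_prod :: "('a::comm_ring_1, 'n::{finite,linorder}) clifford list \<Rightarrow> ('a, 'n) clifford"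
  where "cl_prod xs = foldr (\<star>) xs cl_one"

definition cl_vec :: "('n::{finite,linorder}) lvec \<Rightarrow> (real, 'n) clifford"
  where "cl_vec v = (\<Sum>i\<in>UNIV. v $ i *s cl_gen i)"

definition cl_subalgebra :: "('a::comm_ring_1, 'n::{finite,linorder}) clifford set \<Rightarrow> bool"
  where "cl_subalgebra A \<longleftrightarrow> cl_one \<in> A \<and>
    (\<forall>x\<in>A. \<forall>y\<in>A. x + y \<in> A \<and> x \<star> y \<in> A) \<and> (\<forall>c. \<forall>x\<in>A. c *s x \<in> A)"

definition Cl_n :: "('a::comm_ring_1, 'n::{finite,linorder}) clifford set"
  where "Cl_n = cl_subalgebra hull {cl_gen i | i. i \<noteq> last_ix}"

definition cl_omega :: "('a::comm_ring_1, 'n::{finite,linorder}) clifford"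
  where "cl_omega = cl_prod (map cl_gen (sorted_list_of_set {i. i \<noteq> last_ix}))"

definition cl_complexify :: "(real, 'n::finite) clifford \<Rightarrow> (complex, 'n) clifford"
  where "cl_complexify x = (\<chi> I. complex_of_real (x $ I))"

text \<open>
  That \<open>\<star>\<close> is the Clifford product follows from \<open>cl_mult_assoc\<close>, \<open>cl_one_mult\<close>,
  \<open>cl_vec_square\<close> (the relation \<open>v\<^sup>2 = -q(v) 1\<close>) and \<open>cl_prod_gen\<close> below.
\<close>

lemma cl_fac_sq: "cl_fac i j * cl_fac i j = (1 :: 'a::comm_ring_1)"
  by (simp add: cl_fac_def lor_sgn_def)

lemma prod_sym_diff:
  fixes f :: "'b \<Rightarrow> 'a::comm_ring_1"
  assumes "finite I" "finite J" "\<And>i. f i * f i = 1"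
  shows "prod f (sym_diff I J) = prod f I * prod f J"
proof -
  have 1: "prod f (I \<inter> J) * prod f (I \<inter> J) = 1"
    by (simp add: prod.distrib[symmetric] assms)
  have 2: "prod f I = prod f (I - J) * prod f (I \<inter> J)"
    using assms by (subst prod.union_disjoint[symmetric]) (auto intro: prod.cong)
  have 3: "prod f J = prod f (J - I) * prod f (I \<inter> J)"
    using assms by (subst prod.union_disjoint[symmetric]) (auto intro: prod.cong)
  have 4: "prod f (sym_diff I J) = prod f (I - J) * prod f (J - I)"
    using assms by (subst prod.union_disjoint) auto
  have "prod f I * prod f J
      = prod f (I - J) * prod f (J - I) * (prod f (I \<inter> J) * prod f (I \<inter> J))"
    by (simp only: 2 3 mult_ac)
  then show ?thesis by (simp add: 1 4)
qed

lemma cl_sign_sym_diff_left: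
  "cl_sign (sym_diff I J) K = (cl_sign I K * cl_sign J K :: 'a::comm_ring_1)"
  unfolding cl_sign_def
  by (rule prod_sym_diff) (auto simp: prod.distrib[symmetric] cl_fac_sq)

lemma cl_sign_sym_diff_right:
  "cl_sign K (sym_diff I J) = (cl_sign K I * cl_sign K J :: 'a::comm_ring_1)"
proof -
  have "(\<Prod>j\<in>sym_diff I J. cl_fac i j)
      = (\<Prod>j\<in>I. cl_fac i j) * (\<Prod>j\<in>J. cl_fac i j :: 'a)" for i
    by (rule prod_sym_diff) (auto simp: cl_fac_sq)
  then show ?thesis by (simp only: cl_sign_def prod.distrib)
qed

lemma sym_diff_cancel: "sym_diff I (sym_diff I J) = J"
  by auto

lemma cl_mult_nth:
  "(x \<star> y) $ K = (\<Sum>I\<in>UNIV. cl_sign I (sym_diff I K) * x $ I * y $ sym_diff I K)"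
proof -
  have "(x \<star> y) $ K = (\<Sum>(I, J) | sym_diff I J = K. cl_sign I J * x $ I * y $ J)"
    by (simp add: cl_mult_def)
  also have "{(I, J). sym_diff I J = K} = (\<lambda>I. (I, sym_diff I K)) ` UNIV"
    by (auto simp: image_iff sym_diff_cancel)
  also have "(\<Sum>(I, J)\<in>\<dots>. cl_sign I J * x $ I * y $ J)
      = (\<Sum>I\<in>UNIV. cl_sign I (sym_diff I K) * x $ I * y $ sym_diff I K)"
    by (subst sum.reindex) (auto simp: inj_on_def)
  finally show ?thesis .
qed

lemma cl_mult_assoc: "(x \<star> y) \<star> z = x \<star> (y \<star> z)"
  for x y z :: "('a::comm_ring_1, 'n::{finite,linorder}) clifford"
proof (rule vec_eq_iff[THEN iffD2], rule allI)
  fix K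
  have "((x \<star> y) \<star> z) $ K = (\<Sum>L\<in>UNIV. \<Sum>I\<in>UNIV. cl_sign L (sym_diff L K) *
      (cl_sign I (sym_diff I L) * x $ I * y $ sym_diff I L) * z $ sym_diff L K)"
    by (simp add: cl_mult_nth sum_distrib_left sum_distrib_right)
  also have "\<dots> = (\<Sum>I\<in>UNIV. \<Sum>L\<in>UNIV. cl_sign L (sym_diff L K) *
      (cl_sign I (sym_diff I L) * x $ I * y $ sym_diff I L) * z $ sym_diff L K)"
    by (rule sum.swap)
  also have "\<dots> = (\<Sum>I\<in>UNIV. \<Sum>J\<in>UNIV. cl_sign I (sym_diff I K) * x $ I *
      (cl_sign J (sym_diff J (sym_diff I K)) * y $ J * z $ sym_diff J (sym_diff I K)))"
  proof (rule sum.cong[OF refl])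
    fix I
    show "(\<Sum>L\<in>UNIV. cl_sign L (sym_diff L K) *
        (cl_sign I (sym_diff I L) * x $ I * y $ sym_diff I L) * z $ sym_diff L K)
      = (\<Sum>J\<in>UNIV. cl_sign I (sym_diff I K) * x $ I *
        (cl_sign J (sym_diff J (sym_diff I K)) * y $ J * z $ sym_diff J (sym_diff I K)))"
    proof (rule sum.reindex_bij_witness[where i = "sym_diff I" and j = "sym_diff I"])
      fix L
      define J where "J = sym_diff I L"
      define M where "M = sym_diff L K"
      have M: "sym_diff J (sym_diff I K) = M"
        by (auto simp: J_def M_def)
      have 1: "cl_sign I (sym_diff I K) = (cl_sign I J * cl_sign I M :: 'a)"
        unfolding cl_sign_sym_diff_right[symmetric]
        by (rule arg_cong[where f = "cl_sign I"]) (auto simp: J_def M_def)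
      have 2: "cl_sign L M = (cl_sign I M * cl_sign J M :: 'a)"
        unfolding cl_sign_sym_diff_left[symmetric]
        by (rule arg_cong[where f = "\<lambda>L. cl_sign L M"]) (auto simp: J_def)
      show "cl_sign I (sym_diff I K) * x $ I * (cl_sign (sym_diff I L)
          (sym_diff (sym_diff I L) (sym_diff I K)) * y $ sym_diff I L *
            z $ sym_diff (sym_diff I L) (sym_diff I K))
        = cl_sign L (sym_diff L K) *
          (cl_sign I (sym_diff I L) * x $ I * y $ sym_diff I L) * z $ sym_diff L K"
        by (simp only: J_def[symmetric] M M_def[symmetric] 1 2 mult_ac)
    qed auto
  qed
  also have "\<dots> = (x \<star> (y \<star> z)) $ K"
    by (simp add: cl_mult_nth sum_distrib_left)
  finally show "((x \<star> y) \<star> z) $ K = (x \<star> (y \<star> z)) $ K" .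
qed

lemma cl_mult_axis: "axis I a \<star> axis J b = axis (sym_diff I J) (cl_sign I J * a * b)"
proof (rule vec_eq_iff[THEN iffD2], rule allI)
  fix K
  have "(axis I a \<star> axis J b) $ K
      = (\<Sum>I'\<in>UNIV. if I' = I then cl_sign I (sym_diff I K) * a * axis J b $ sym_diff I K else 0)"
    unfolding cl_mult_nth by (rule sum.cong) (auto simp: axis_def)
  also have "\<dots> = cl_sign I (sym_diff I K) * a * axis J b $ sym_diff I K"
    by simp
  also have "\<dots> = axis (sym_diff I J) (cl_sign I J * a * b) $ K"
  proof (cases "sym_diff I K = J")
    case True
    then have "K = sym_diff I J" by auto
    with True show ?thesis by (simp add: axis_def)
  next
    case False
    then have "K \<noteq> sym_diff I J" by auto
    with False show ?thesis by (simp add: axis_def)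
  qed
  finally show "(axis I a \<star> axis J b) $ K = axis (sym_diff I J) (cl_sign I J * a * b) $ K" .
qed

lemma cl_mult_add_left: "(x + y) \<star> z = x \<star> z + y \<star> z"
  and cl_mult_add_right: "z \<star> (x + y) = z \<star> x + z \<star> y"
  by (simp_all add: vec_eq_iff cl_mult_nth algebra_simps sum.distrib)

lemma cl_mult_scale_left: "(c *s x) \<star> y = c *s (x \<star> y)"
  and cl_mult_scale_right: "x \<star> (c *s y) = c *s (x \<star> y)"
  by (simp_all add: vec_eq_iff cl_mult_nth sum_distrib_left mult_ac)

lemma cl_mult_zero: "0 \<star> x = 0" "x \<star> 0 = 0"
  by (simp_all add: vec_eq_iff cl_mult_nth)

lemma cl_mult_sum_left: "sum g A \<star> x = (\<Sum>a\<in>A. g a \<star> x)"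
  and cl_mult_sum_right: "x \<star> sum g A = (\<Sum>a\<in>A. x \<star> g a)"
  by (induction A rule: infinite_finite_induct)
    (simp_all add: cl_mult_zero cl_mult_add_left cl_mult_add_right)

lemma cl_one_mult: "cl_one \<star> x = x" "x \<star> cl_one = x"
  for x :: "('a::comm_ring_1, 'n::{finite,linorder}) clifford"
proof -
  have "(cl_one \<star> x) $ K = (\<Sum>I\<in>UNIV. if I = ({} :: 'n set) then x $ K else 0)" for K
    unfolding cl_mult_nth by (intro sum.cong refl) (auto simp: cl_one_def axis_def cl_sign_def)
  then show "cl_one \<star> x = x" by (simp add: vec_eq_iff)
  have "(x \<star> cl_one) $ K = (\<Sum>I\<in>UNIV. if I = K then x $ K else 0)" for K
  proof -
    have eq: "sym_diff I K = {} \<longleftrightarrow> I = K" for I by auto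
    show ?thesis
      unfolding cl_mult_nth
      by (intro sum.cong refl) (auto simp: cl_one_def axis_def cl_sign_def eq[simplified])
  qed
  then show "x \<star> cl_one = x" by (simp add: vec_eq_iff)
qed

lemma cl_gen_mult:
  "cl_gen i \<star> cl_gen i = (- lor_sgn i) *s cl_one"
  "i \<noteq> j \<Longrightarrow> cl_gen i \<star> cl_gen j = - (cl_gen j \<star> cl_gen i)"
  unfolding cl_gen_def cl_one_def cl_mult_axis
  by (auto simp: cl_sign_def cl_fac_def vec_eq_iff axis_def)

lemma cl_vec_square: "cl_vec v \<star> cl_vec v = (- lor_q v) *s cl_one"
proof -
  define g where "g i j = (v $ i * v $ j) *s (cl_gen i \<star> cl_gen j)" for i j
  have anti: "g i j = - g j i" if "i \<noteq> j" for i j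
    by (simp add: g_def cl_gen_mult(2)[OF that] vec_eq_iff mult_ac)
  have diag: "g i i = (- (lor_sgn i * (v $ i)\<^sup>2)) *s cl_one" for i
    by (simp add: g_def cl_gen_mult(1) vec_eq_iff power2_eq_square)
  have S: "cl_vec v \<star> cl_vec v = (\<Sum>i\<in>UNIV. \<Sum>j\<in>UNIV. g i j)"
    unfolding cl_vec_def cl_mult_sum_left unfolding cl_mult_sum_right
    by (intro sum.cong refl)
      (simp only: g_def cl_mult_scale_left cl_mult_scale_right vector_smult_assoc mult.commute)
  have "(\<Sum>i\<in>UNIV. \<Sum>j\<in>UNIV. g i j) + (\<Sum>i\<in>UNIV. \<Sum>j\<in>UNIV. g j i)
      = (\<Sum>i\<in>UNIV. \<Sum>j\<in>UNIV. if i = j then 2 *s g i i else 0)"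
  proof -
    have "g i j + g j i = (if i = j then 2 *s g i i else 0)" for i j
      by (cases "i = j") (simp add: vec_eq_iff, simp add: anti[of i j])
    then show ?thesis by (simp only: sum.distrib[symmetric])
  qed
  also have "(\<Sum>i\<in>UNIV. \<Sum>j\<in>UNIV. g j i) = (\<Sum>i\<in>UNIV. \<Sum>j\<in>UNIV. g i j)"
    by (rule sum.swap)
  finally have "(\<Sum>i\<in>UNIV. \<Sum>j\<in>UNIV. g i j) = (\<Sum>i\<in>UNIV. g i i)"
    by (simp add: vec_eq_iff sum_distrib_left[symmetric])
  then show ?thesis
    by (simp add: S diag lor_q_def vec_eq_iff sum_distrib_right sum_negf)
qed

lemma cl_prod_gen: "cl_prod (map cl_gen (sorted_list_of_set I)) = axis I (1 :: 'a::comm_ring_1)"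
  for I :: "'n::{finite,linorder} set"
proof -
  have "sorted_wrt (<) xs \<Longrightarrow> cl_prod (map cl_gen xs) = axis (set xs) (1 :: 'a)" for xs :: "'n list"
  proof (induction xs)
    case Nil
    then show ?case by (simp add: cl_prod_def cl_one_def)
  next
    case (Cons i xs)
    then have "i \<notin> set xs" by auto
    then have sd: "sym_diff {i} (set xs) = set (i # xs)" by auto
    have "cl_fac i j = (1 :: 'a)" if "j \<in> set xs" for j
      using Cons.prems that by (fastforce simp: cl_fac_def)
    then have "cl_sign {i} (set xs) = (1 :: 'a)"
      by (simp add: cl_sign_def)
    then have "cl_gen i \<star> axis (set xs) (1 :: 'a) = axis (set (i # xs)) 1"
      by (simp only: cl_gen_def cl_mult_axis sd mult_1_left)
    with Cons show ?case by (simp add: cl_prod_def)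
  qed
  from this[of "sorted_list_of_set I"] show ?thesis by simp
qed

section \<open>Spin groups\<close>

definition Spin_set :: "(real, 'n::{finite,linorder}) clifford set"
  where "Spin_set = {cl_prod (map cl_vec vs) | vs.
    even (length vs) \<and> (\<forall>v\<in>set vs. lor_q v = 1 \<or> lor_q v = -1)}"

definition Spin_plus :: "(real, 'n::{finite,linorder}) clifford monoid"
  where "Spin_plus =
    \<lparr>carrier = connected_component_set Spin_set cl_one, mult = (\<star>), one = cl_one\<rparr>"

definition cl_inv :: "(real, 'n::{finite,linorder}) clifford \<Rightarrow> (real, 'n) clifford"
  where "cl_inv x = (THE y. x \<star> y = cl_one \<and> y \<star> x = cl_one)"

definition Ad :: "(real, 'n::{finite,linorder}) clifford \<Rightarrow> 'n lmat"
  where "Ad x = matrix (\<lambda>w. THE u. cl_vec u = x \<star> cl_vec w \<star> cl_inv x)"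

text \<open>\<open>Spin(n)\<close>, identified with the stabilizer of \<open>e\<^sub>n\<^sub>+\<^sub>1\<close>.\<close>

definition Spin_n :: "(real, 'n::{finite,linorder}) clifford set"
  where "Spin_n = {s \<in> carrier Spin_plus. Ad s *v e_last = e_last}"

section \<open>Complex spin representations\<close>

definition complex_alg_hom_on :: "(complex, 'n::{finite,linorder}) clifford set \<Rightarrow>
    (complex \<Rightarrow> 'b \<Rightarrow> 'b) \<Rightarrow> ('b \<Rightarrow> 'b \<Rightarrow> 'b) \<Rightarrow> 'b::ab_group_add \<Rightarrow>
    ((complex, 'n) clifford \<Rightarrow> 'b) \<Rightarrow> bool"
  where "complex_alg_hom_on A smul mul one' h \<longleftrightarrow> h cl_one = one' \<and>
    (\<forall>x\<in>A. \<forall>y\<in>A. h (x + y) = h x + h y \<and> h (x \<star> y) = mul (h x) (h y)) \<and>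
    (\<forall>c. \<forall>x\<in>A. h (c *s x) = smul c (h x))"

definition is_psi :: "((complex, 'n::{finite,linorder}) clifford \<Rightarrow> complex ^ 'k ^ 'k) \<Rightarrow> bool"
  where "is_psi \<psi> \<longleftrightarrow>
    complex_alg_hom_on Cl_n (\<lambda>c M. mat c ** M) (**) (mat 1) \<psi> \<and> bij_betw \<psi> Cl_n UNIV"

definition is_rho :: "nat \<Rightarrow> complex \<Rightarrow>
    ((complex, 'n::{finite,linorder}) clifford \<Rightarrow> (complex, 'n) clifford) \<Rightarrow> bool"
  where "is_rho m \<epsilon> \<rho> \<longleftrightarrow>
    complex_alg_hom_on UNIV (*s) (\<star>) cl_one \<rho> \<and> range \<rho> \<subseteq> Cl_n \<and>
    (\<forall>i. i \<noteq> last_ix \<longrightarrow> \<rho> (cl_gen i) = cl_gen i) \<and>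
    \<rho> (cl_gen last_ix) = (\<epsilon> * \<i> ^ m) *s cl_omega"

definition Delta_n :: "((complex, 'n::{finite,linorder}) clifford \<Rightarrow> complex ^ 'k ^ 'k) \<Rightarrow>
    (real, 'n) clifford \<Rightarrow> complex ^ 'k ^ 'k"
  where "Delta_n \<psi> s = \<psi> (cl_complexify s)"

definition Delta_n1 :: "((complex, 'n::{finite,linorder}) clifford \<Rightarrow> complex ^ 'k ^ 'k) \<Rightarrow>
    ((complex, 'n) clifford \<Rightarrow> (complex, 'n) clifford) \<Rightarrow>
    (real, 'n) clifford \<Rightarrow> complex ^ 'k ^ 'k"
  where "Delta_n1 \<psi> \<rho> g = \<psi> (\<rho> (cl_complexify g))"

section \<open>The spinor bundle\<close>

text \<open>\<open>\<Gamma>h\<close> is the lift of \<open>\<Gamma>\<close> to the spin group and \<open>\<Delta>\<close> the representation of \<open>Spin_n\<close>.\<close>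

type_synonym ('n, 'k) spinor = "((real, 'n) clifford set \<times> (complex, 'k) vec) set"

definition spin_act :: "((real, 'n::{finite,linorder}) clifford \<Rightarrow> complex ^ 'k ^ 'k) \<Rightarrow>
    (real, 'n) clifford set \<times> (complex ^ 'k) \<Rightarrow> (real, 'n) clifford \<Rightarrow>
    (real, 'n) clifford set \<times> (complex ^ 'k)"
  where "spin_act \<Delta> p s = (fst p #>\<^bsub>Spin_plus\<^esub> s, matrix_inv (\<Delta> s) *v snd p)"

definition spinor_pt :: "(real, 'n::{finite,linorder}) clifford set \<Rightarrow>
    ((real, 'n) clifford \<Rightarrow> complex ^ 'k ^ 'k) \<Rightarrow>
    (real, 'n) clifford \<Rightarrow> complex ^ 'k \<Rightarrow> ('n, 'k) spinor"
  where "spinor_pt \<Gamma>h \<Delta> g v = spin_act \<Delta> (\<Gamma>h #>\<^bsub>Spin_plus\<^esub> g, v) ` Spin_n"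

definition spinor_bundle :: "(real, 'n::{finite,linorder}) clifford set \<Rightarrow>
    ((real, 'n) clifford \<Rightarrow> complex ^ 'k ^ 'k) \<Rightarrow> ('n, 'k) spinor set"
  where "spinor_bundle \<Gamma>h \<Delta> = {spinor_pt \<Gamma>h \<Delta> g v | g v. g \<in> carrier Spin_plus}"

definition spinor_proj :: "'n lmat set \<Rightarrow> (real, 'n::{finite,linorder}) clifford set \<Rightarrow>
    ((real, 'n) clifford \<Rightarrow> complex ^ 'k ^ 'k) \<Rightarrow> ('n, 'k) spinor \<Rightarrow> 'n lvec set"
  where "spinor_proj \<Gamma> \<Gamma>h \<Delta> P = (THE b. \<exists>g v. g \<in> carrier Spin_plus \<and>
    P = spinor_pt \<Gamma>h \<Delta> g v \<and> b = orb \<Gamma> (Ad g *v e_last))"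

definition spinor_fiber :: "'n lmat set \<Rightarrow> (real, 'n::{finite,linorder}) clifford set \<Rightarrow>
    ((real, 'n) clifford \<Rightarrow> complex ^ 'k ^ 'k) \<Rightarrow> 'n lvec set \<Rightarrow> ('n, 'k) spinor set"
  where "spinor_fiber \<Gamma> \<Gamma>h \<Delta> b = {P \<in> spinor_bundle \<Gamma>h \<Delta>. spinor_proj \<Gamma> \<Gamma>h \<Delta> P = b}"

text \<open>The vector space operations of the fibers; \<open>spinor_add\<close> is meaningful within one fiber only.\<close>

definition spinor_add :: "(real, 'n::{finite,linorder}) clifford set \<Rightarrow>
    ((real, 'n) clifford \<Rightarrow> complex ^ 'k ^ 'k) \<Rightarrow>
    ('n, 'k) spinor \<Rightarrow> ('n, 'k) spinor \<Rightarrow> ('n, 'k) spinor"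
  where "spinor_add \<Gamma>h \<Delta> P Q = (THE R. \<exists>g v w. g \<in> carrier Spin_plus \<and>
    P = spinor_pt \<Gamma>h \<Delta> g v \<and> Q = spinor_pt \<Gamma>h \<Delta> g w \<and> R = spinor_pt \<Gamma>h \<Delta> g (v + w))"

definition spinor_scale :: "(real, 'n::{finite,linorder}) clifford set \<Rightarrow>
    ((real, 'n) clifford \<Rightarrow> complex ^ 'k ^ 'k) \<Rightarrow>
    complex \<Rightarrow> ('n, 'k) spinor \<Rightarrow> ('n, 'k) spinor"
  where "spinor_scale \<Gamma>h \<Delta> c P = (THE R. \<exists>g v. g \<in> carrier Spin_plus \<and>
    P = spinor_pt \<Gamma>h \<Delta> g v \<and> R = spinor_pt \<Gamma>h \<Delta> g (c *s v))"

definition spinor_aut :: "(real, 'n::{finite,linorder}) clifford set \<Rightarrow>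
    ((real, 'n) clifford \<Rightarrow> complex ^ 'k ^ 'k) \<Rightarrow>
    (real, 'n) clifford \<Rightarrow> ('n, 'k) spinor \<Rightarrow> ('n, 'k) spinor"
  where "spinor_aut \<Gamma>h \<Delta> fh P = (THE Q. \<exists>g v. g \<in> carrier Spin_plus \<and>
    P = spinor_pt \<Gamma>h \<Delta> g v \<and> Q = spinor_pt \<Gamma>h \<Delta> (fh \<star> g) v)"

section \<open>Trace of an endomorphism of a complex vector space\<close>

definition lin_coords :: "'v set \<Rightarrow> ('v \<Rightarrow> 'v \<Rightarrow> 'v) \<Rightarrow> (complex \<Rightarrow> 'v \<Rightarrow> 'v) \<Rightarrow>
    (complex ^ 'k \<Rightarrow> 'v) \<Rightarrow> bool"
  where "lin_coords V add smul \<beta> \<longleftrightarrow> bij_betw \<beta> UNIV V \<and>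
    (\<forall>v w. \<beta> (v + w) = add (\<beta> v) (\<beta> w)) \<and> (\<forall>c v. \<beta> (c *s v) = smul c (\<beta> v))"

text \<open>The index type \<open>'k\<close> of the coordinates has to be specified: its cardinality is the
  dimension of \<open>V\<close>.\<close>

definition lin_trace :: "'k::finite itself \<Rightarrow> 'v set \<Rightarrow> ('v \<Rightarrow> 'v \<Rightarrow> 'v) \<Rightarrow>
    (complex \<Rightarrow> 'v \<Rightarrow> 'v) \<Rightarrow> ('v \<Rightarrow> 'v) \<Rightarrow> complex"
  where "lin_trace TYPE('k) V add smul T = (THE t. \<exists>\<beta> :: complex ^ 'k \<Rightarrow> 'v.
    lin_coords V add smul \<beta> \<and> t = trace (matrix (inv_into UNIV \<beta> \<circ> T \<circ> \<beta>)))"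

end

theory Submission
  imports Defs
begin

text \<open>
  Choose \<open>g\<close> in \<open>Spin\<^sup>+(n,1)\<close> with \<open>Ad(g) e\<^sub>n\<^sub>+\<^sub>1 = x\<close>. Since \<open>\<Gamma>\<close> acts freely on hyperbolic space,
  sending \<open>v\<close> to the class of \<open>(\<Gamma>h g, v)\<close> identifies \<open>\<complex>\<^sup>k\<close> with the fiber over \<open>\<Gamma>x\<close>. As \<open>\<gamma> f\<close>
  fixes \<open>x\<close>, the element \<open>s = g\<^sup>-\<^sup>1 \<gamma>h fh g\<close> lies in \<open>Spin(n)\<close>, and in these coordinates the
  automorphism is \<open>\<Delta>\<^sub>n(s)\<close>. An even element commuting with \<open>e\<^sub>n\<^sub>+\<^sub>1\<close> does not involve \<open>e\<^sub>n\<^sub>+\<^sub>1\<close>, so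
  \<open>\<Delta>\<^sub>n\<^sub>,\<^sub>1\<close> extends \<open>\<Delta>\<^sub>n\<close>, and \<open>s\<close> is conjugate to \<open>\<gamma>h fh\<close> in \<open>Spin\<^sup>+(n,1)\<close>.
\<close>

section \<open>Vectors inside the Clifford algebra\<close>

lemma cl_vec_nth: "cl_vec v $ I = (if \<exists>i. I = {i} then v $ (THE i. I = {i}) else 0)"
proof -
  have "cl_vec v $ I = (\<Sum>i\<in>UNIV. v $ i * (if I = {i} then 1 else 0))"
    by (simp add: cl_vec_def cl_gen_def axis_def)
  also have "\<dots> = (if \<exists>i. I = {i} then v $ (THE i. I = {i}) else 0)"
    by (auto simp: if_distrib sum.delta cong: if_cong)
  finally show ?thesis .
qed

lemma cl_vec_nth_singleton: "cl_vec v $ {i} = v $ i"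
  by (simp add: cl_vec_nth)

lemma cl_vec_inject: "cl_vec v = cl_vec w \<longleftrightarrow> v = w"
  by (metis cl_vec_nth_singleton vec_eq_iff)

lemma cl_vec_add: "cl_vec (v + w) = cl_vec v + cl_vec w"
  and cl_vec_scale: "cl_vec (c *s v) = c *s cl_vec v"
  by (simp_all add: vec_eq_iff cl_vec_nth)

lemma lor_q_add: "lor_q (v + w) = lor_q v + lor_q w + 2 * lor_inner v w"
  by (simp add: lor_q_def lor_inner_def sum.distrib[symmetric] sum_distrib_left algebra_simps power2_eq_square)

lemma lor_q_scale: "lor_q (c *s v) = c\<^sup>2 * lor_q v"
  by (simp add: lor_q_def sum_distrib_left algebra_simps power_mult_distrib)

text \<open>Polarization of v^2 = -q(v) 1, with \<open>lor_q_add\<close> as the polarization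
  identity.\<close>

lemma cl_vec_anticommutator:
  "cl_vec v \<star> cl_vec w + cl_vec w \<star> cl_vec v = (- 2 * lor_inner v w) *s cl_one"
proof -
  have "cl_vec v \<star> cl_vec w + cl_vec w \<star> cl_vec v
      = cl_vec (v + w) \<star> cl_vec (v + w) - cl_vec v \<star> cl_vec v - cl_vec w \<star> cl_vec w"
    by (simp add: cl_vec_add cl_mult_add_left cl_mult_add_right)
  also have "\<dots> = (- 2 * lor_inner v w) *s cl_one"
    unfolding cl_vec_square lor_q_add by (simp add: vec_eq_iff algebra_simps)
  finally show ?thesis .
qed

lemma cl_vec_mult_inverse:
  assumes "lor_q v = 1 \<or> lor_q v = -1"
  shows "cl_vec v \<star> cl_vec ((- lor_q v) *s v) = cl_one" "cl_vec ((- lor_q v) *s v) \<star> cl_vec v = cl_one"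
  unfolding cl_vec_scale cl_mult_scale_left cl_mult_scale_right cl_vec_square
  using assms by (auto simp: vec_eq_iff)

text \<open>This is minus the reflection in the hyperplane orthogonal to v. The anticommutator moves
  v past w, after which v meets its inverse; since q(v) is 1 or -1, multiplying by q(v) replaces
  dividing by it.\<close>

lemma cl_vec_conj:
  assumes "lor_q v = 1 \<or> lor_q v = -1"
  shows "cl_vec v \<star> cl_vec w \<star> cl_vec ((- lor_q v) *s v)
    = cl_vec ((2 * lor_inner v w * lor_q v) *s v - w)"
proof -
  have 1: "cl_vec v \<star> cl_vec w = (- 2 * lor_inner v w) *s cl_one - cl_vec w \<star> cl_vec v"
    using cl_vec_anticommutator[of v w] by (simp add: algebra_simps)
  have "cl_vec v \<star> cl_vec w \<star> cl_vec ((- lor_q v) *s v)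
     = (- 2 * lor_inner v w) *s cl_vec ((- lor_q v) *s v) - cl_vec w"
    unfolding 1 diff_conv_add_uminus vector_sneg_minus1[of "cl_vec w \<star> cl_vec v"]
      cl_mult_add_left cl_mult_scale_left cl_one_mult cl_mult_assoc cl_vec_mult_inverse(1)[OF assms]
    by (simp add: cl_vec_mult_inverse[OF assms] cl_one_mult)
  also have "\<dots> = cl_vec ((2 * lor_inner v w * lor_q v) *s v - w)"
    by (simp add: vec_eq_iff cl_vec_nth)
  finally show ?thesis .
qed

section \<open>Products of unit vectors\<close>

lemma cl_prod_Cons: "cl_prod (x # xs) = x \<star> cl_prod xs"
  by (simp add: cl_prod_def)

lemma cl_prod_append: "cl_prod (xs @ ys) = cl_prod xs \<star> cl_prod ys"
  by (induction xs) (simp_all add: cl_prod_def cl_one_mult cl_mult_assoc)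

text \<open>The inverse of a product lists the inverses of the factors in reverse order. In the
  induction the innermost pair cancels, and each conjugation by a single vector stays within the
  vectors by \<open>cl_vec_conj\<close>.\<close>

lemma cl_prod_units:
  fixes vs :: "('n::{finite,linorder}) lvec list"
  assumes "\<forall>v\<in>set vs. lor_q v = 1 \<or> lor_q v = -1"
  defines "x \<equiv> cl_prod (map cl_vec vs)"
    and "y \<equiv> cl_prod (map cl_vec (rev (map (\<lambda>v. (- lor_q v) *s v) vs)))"
  shows "x \<star> y = cl_one" "y \<star> x = cl_one" "\<exists>u. x \<star> cl_vec w \<star> y = cl_vec u"
  unfolding x_def y_def using assms(1)
proof (induction vs arbitrary: w)
  case Nil
  { case 1 show ?case by (simp add: cl_prod_def cl_one_mult) }
  { case 2 show ?case by (simp add: cl_prod_def cl_one_mult) }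
  { case 3 show ?case by (auto simp: cl_prod_def cl_one_mult) }
next
  case (Cons v vs)
  let ?x = "cl_prod (map cl_vec vs)"
  let ?y = "cl_prod (map cl_vec (rev (map (\<lambda>v. (- lor_q v) *s v) vs)))"
  let ?v' = "cl_vec ((- lor_q v) *s v)"
  have X: "cl_prod (map cl_vec (v # vs)) = cl_vec v \<star> ?x" by (simp add: cl_prod_Cons)
  have Y: "cl_prod (map cl_vec (rev (map (\<lambda>v. (- lor_q v) *s v) (v # vs)))) = ?y \<star> ?v'"
    by (simp only: list.map rev.simps map_append cl_prod_append)
       (simp only: cl_prod_def foldr.simps o_apply id_apply cl_one_mult)
  { case 1
    have "(cl_vec v \<star> ?x) \<star> (?y \<star> ?v') = cl_vec v \<star> (?x \<star> ?y) \<star> ?v'" by (simp add: cl_mult_assoc)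
    then show ?case unfolding X Y using Cons.IH(1) 1 cl_vec_mult_inverse(1)[of v] by (simp add: cl_one_mult) }
  { case 2
    have "(?y \<star> ?v') \<star> (cl_vec v \<star> ?x) = ?y \<star> (?v' \<star> cl_vec v) \<star> ?x" by (simp only: cl_mult_assoc)
    then show ?case unfolding X Y using Cons.IH(2) 2 cl_vec_mult_inverse(2)[of v] by (simp add: cl_one_mult) }
  { case 3
    obtain u where "?x \<star> cl_vec w \<star> ?y = cl_vec u" using Cons.IH(3) 3 by auto
    moreover have "(cl_vec v \<star> ?x) \<star> cl_vec w \<star> (?y \<star> ?v') = cl_vec v \<star> (?x \<star> cl_vec w \<star> ?y) \<star> ?v'"
      by (simp only: cl_mult_assoc)
    ultimately show ?case unfolding X Y using 3 cl_vec_conj[of v u] by auto }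
qed

lemma Spin_set_mult: "x \<in> Spin_set \<Longrightarrow> y \<in> Spin_set \<Longrightarrow> x \<star> y \<in> Spin_set"
proof -
  assume "x \<in> Spin_set" "y \<in> Spin_set"
  then obtain vs ws where
    "x = cl_prod (map cl_vec vs)" "y = cl_prod (map cl_vec ws)" "even (length (vs @ ws))"
    "\<forall>v\<in>set (vs @ ws). lor_q v = 1 \<or> lor_q v = -1"
    unfolding Spin_set_def by auto
  then show ?thesis unfolding Spin_set_def
    by (intro CollectI exI[of _ "vs @ ws"]) (simp add: cl_prod_append)
qed

lemma cl_one_in_Spin_set: "cl_one \<in> Spin_set"
  unfolding Spin_set_def by (intro CollectI exI[of _ "[]"]) (simp add: cl_prod_def)

lemma cl_inv_eqI: "x \<star> y = cl_one \<Longrightarrow> y \<star> x = cl_one \<Longrightarrow> cl_inv x = y"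
  unfolding cl_inv_def by (rule the_equality) (auto, metis cl_mult_assoc cl_one_mult)

lemma Spin_set_inv:
  fixes x :: "(real, 'n::{finite,linorder}) clifford"
  assumes "x \<in> Spin_set"
  shows cl_inv_in_Spin_set: "cl_inv x \<in> Spin_set"
    and cl_inv_right: "x \<star> cl_inv x = cl_one"
    and cl_inv_left: "cl_inv x \<star> x = cl_one"
    and Spin_set_conj_vec: "\<exists>u. x \<star> cl_vec w \<star> cl_inv x = cl_vec u"
proof -
  obtain vs where x: "x = cl_prod (map cl_vec vs)" and ev: "even (length vs)"
    and u: "\<forall>v\<in>set vs. lor_q v = 1 \<or> lor_q v = -1"
    using assms unfolding Spin_set_def by auto
  let ?ws = "rev (map (\<lambda>v. (- lor_q v) *s v) vs)"
  note * = cl_prod_units[OF u, folded x]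
  have i: "cl_inv x = cl_prod (map cl_vec ?ws)"
    using *(1,2) by (rule cl_inv_eqI)
  \<comment> \<open>The left side is q(v)^3, which equals q(v) when q(v) is 1 or -1; so the inverse
    is again a product of unit vectors.\<close>
  have "lor_q ((- lor_q v) *s v) = lor_q v" if "lor_q v = 1 \<or> lor_q v = -1" for v :: "'n lvec"
    using that unfolding lor_q_scale by auto
  then have "\<forall>v\<in>set ?ws. lor_q v = 1 \<or> lor_q v = -1"
    using u by (auto simp del: vector_smult_lneg)
  then show "cl_inv x \<in> Spin_set" unfolding i Spin_set_def
    by (intro CollectI exI[of _ ?ws]) (simp add: ev)
  show "x \<star> cl_inv x = cl_one" "cl_inv x \<star> x = cl_one" "\<exists>u. x \<star> cl_vec w \<star> cl_inv x = cl_vec u"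
    unfolding i by (rule *)+
qed

section \<open>The identity component as a group\<close>

lemma linear_cl_mult_right: "linear (\<lambda>y. (x :: (real, 'n::{finite,linorder}) clifford) \<star> y)"
  by (rule linearI) (simp_all add: cl_mult_add_right cl_mult_scale_right flip: scalar_mult_eq_scaleR)

lemma linear_cl_mult_left: "linear (\<lambda>x. x \<star> (y :: (real, 'n::{finite,linorder}) clifford))"
  by (rule linearI) (simp_all add: cl_mult_add_left cl_mult_scale_left flip: scalar_mult_eq_scaleR)

lemma linear_cl_vec: "linear cl_vec"
  by (rule linearI) (simp_all add: cl_vec_add cl_vec_scale flip: scalar_mult_eq_scaleR)

lemma Spin_plus_sel [simp]: "mult Spin_plus = (\<star>)" "one Spin_plus = cl_one"
  by (simp_all add: Spin_plus_def)

lemma Spin_plus_subset: "carrier Spin_plus \<subseteq> Spin_set"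
  by (simp add: Spin_plus_def connected_component_subset)

text \<open>Applied to left translates of the component for the group axioms, and to an explicit
  path for transitivity on hyperbolic space.\<close>

lemma Spin_plusI:
  assumes "connected S" "S \<subseteq> Spin_set" "y \<in> S" "y \<in> carrier Spin_plus" "x \<in> S"
  shows "x \<in> carrier Spin_plus"
proof -
  have "connected_component Spin_set y x"
    using assms by (auto simp: connected_component_def)
  moreover have "connected_component Spin_set cl_one y"
    using assms by (auto simp: Spin_plus_def)
  ultimately show ?thesis by (auto simp: Spin_plus_def intro: connected_component_trans)
qed

lemma cl_one_in_Spin_plus: "cl_one \<in> carrier Spin_plus"
  by (simp add: Spin_plus_def cl_one_in_Spin_set)

lemma connected_cl_translate: "connected ((\<star>) x ` carrier Spin_plus)"
  by (intro connected_continuous_image linear_continuous_on)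
    (auto simp: linear_linear linear_cl_mult_right Spin_plus_def linear_conv_bounded_linear[symmetric])

text \<open>Left translates of the component are connected and stay in \<open>Spin_set\<close>. The
  translate by x contains x itself, which gives closure under products; the translate by x^{-1}
  contains both 1 = x^{-1} x and x^{-1}, which gives inverses.\<close>

lemma group_Spin_plus: "group (Spin_plus :: (real, 'n::{finite,linorder}) clifford monoid)"
proof (rule groupI, unfold Spin_plus_sel)
  fix x y :: "(real, 'n) clifford" assume xy: "x \<in> carrier Spin_plus" "y \<in> carrier Spin_plus"
  show "x \<star> y \<in> carrier Spin_plus"
  proof (rule Spin_plusI[OF connected_cl_translate[of x], where y = x])
    show "(\<star>) x ` carrier Spin_plus \<subseteq> Spin_set"
      using xy Spin_plus_subset by (auto intro: Spin_set_mult)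
    show "x \<in> (\<star>) x ` carrier Spin_plus"
      using cl_one_in_Spin_plus by (metis imageI cl_one_mult(2))
  qed (use xy in auto)
next
  fix x :: "(real, 'n) clifford" assume x: "x \<in> carrier Spin_plus"
  then have xs: "x \<in> Spin_set" using Spin_plus_subset by auto
  have "cl_inv x \<in> carrier Spin_plus"
  proof (rule Spin_plusI[OF connected_cl_translate[of "cl_inv x"], where y = cl_one])
    show "(\<star>) (cl_inv x) ` carrier Spin_plus \<subseteq> Spin_set"
      using Spin_plus_subset cl_inv_in_Spin_set[OF xs] by (auto intro: Spin_set_mult)
    show "cl_one \<in> (\<star>) (cl_inv x) ` carrier Spin_plus"
      using x cl_inv_left[OF xs] by (metis imageI)
    show "cl_inv x \<in> (\<star>) (cl_inv x) ` carrier Spin_plus"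
      using cl_one_in_Spin_plus by (metis imageI cl_one_mult(2))
  qed (rule cl_one_in_Spin_plus)
  then show "\<exists>y\<in>carrier Spin_plus. y \<star> x = cl_one" using cl_inv_left[OF xs] by blast
qed (auto simp: cl_one_in_Spin_plus cl_mult_assoc cl_one_mult)

section \<open>The adjoint action\<close>

text \<open>The description inside \<open>Ad\<close> has a value because conjugation preserves the
  vectors, and only one because \<open>cl_vec\<close> is injective; linearity then lets the matrix
  represent it. The basic properties of \<open>Ad\<close> are computed in the algebra through this
  identity.\<close>

lemma cl_vec_Ad:
  fixes x :: "(real, 'n::{finite,linorder}) clifford"
  assumes "x \<in> Spin_set"
  shows "cl_vec (Ad x *v w) = x \<star> cl_vec w \<star> cl_inv x"
proof -
  define h where "h w = (THE u. cl_vec u = x \<star> cl_vec w \<star> cl_inv x)" for w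
  have h: "cl_vec (h w) = x \<star> cl_vec w \<star> cl_inv x" for w
  proof -
    obtain u where u: "x \<star> cl_vec w \<star> cl_inv x = cl_vec u" using Spin_set_conj_vec[OF assms] by blast
    show ?thesis unfolding h_def u by (simp add: cl_vec_inject)
  qed
  have "linear h"
    by (rule linearI; subst cl_vec_inject[symmetric])
      (simp_all add: h cl_vec_add cl_vec_scale cl_mult_add_left cl_mult_add_right cl_mult_scale_left
        cl_mult_scale_right flip: scalar_mult_eq_scaleR)
  then have "Ad x *v w = h w"
    unfolding Ad_def h_def by (simp add: matrix_works)
  with h show ?thesis by simp
qed

lemma Ad_mult:
  fixes x y :: "(real, 'n::{finite,linorder}) clifford"
  assumes "x \<in> Spin_set" "y \<in> Spin_set"
  shows "Ad (x \<star> y) = Ad x ** Ad y"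
proof -
  have "cl_inv (x \<star> y) = cl_inv y \<star> cl_inv x"
  proof (rule cl_inv_eqI)
    have "x \<star> y \<star> (cl_inv y \<star> cl_inv x) = x \<star> (y \<star> cl_inv y) \<star> cl_inv x"
      "cl_inv y \<star> cl_inv x \<star> (x \<star> y) = cl_inv y \<star> (cl_inv x \<star> x) \<star> y"
      by (simp_all only: cl_mult_assoc)
    then show "x \<star> y \<star> (cl_inv y \<star> cl_inv x) = cl_one" "cl_inv y \<star> cl_inv x \<star> (x \<star> y) = cl_one"
      using assms by (simp_all add: cl_inv_left cl_inv_right cl_one_mult)
  qed
  then have "cl_vec (Ad (x \<star> y) *v w) = cl_vec ((Ad x ** Ad y) *v w)" for w
    using assms by (simp add: cl_vec_Ad Spin_set_mult cl_mult_assoc flip: matrix_vector_mul_assoc)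
  then show ?thesis by (simp add: cl_vec_inject matrix_eq)
qed

lemma Ad_one: "Ad (cl_one :: (real, 'n::{finite,linorder}) clifford) = mat 1"
proof -
  have "cl_inv cl_one = (cl_one :: (real, 'n) clifford)"
    by (rule cl_inv_eqI) (simp_all add: cl_one_mult)
  then have "cl_vec (Ad (cl_one :: (real, 'n) clifford) *v w) = cl_vec (mat 1 *v w)" for w
    by (simp add: cl_vec_Ad cl_one_in_Spin_set cl_one_mult)
  then show ?thesis by (simp add: cl_vec_inject matrix_eq)
qed

text \<open>The square of x w x^{-1} is x w^2 x^{-1}, and w^2 is a scalar, so conjugation leaves it
  unchanged.\<close>

lemma lor_q_Ad:
  fixes x :: "(real, 'n::{finite,linorder}) clifford"
  assumes "x \<in> Spin_set" shows "lor_q (Ad x *v w) = lor_q w"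
proof -
  have "cl_vec (Ad x *v w) \<star> cl_vec (Ad x *v w) = x \<star> cl_vec w \<star> (cl_inv x \<star> x) \<star> cl_vec w \<star> cl_inv x"
    by (simp only: cl_vec_Ad[OF assms] cl_mult_assoc)
  also have "\<dots> = x \<star> (cl_vec w \<star> cl_vec w) \<star> cl_inv x"
    by (simp only: cl_inv_left[OF assms] cl_one_mult cl_mult_assoc)
  also have "\<dots> = (- lor_q w) *s cl_one"
    by (simp only: cl_vec_square cl_mult_scale_left cl_mult_scale_right cl_one_mult cl_inv_right[OF assms])
  finally show ?thesis
    unfolding cl_vec_square by (simp add: vec_eq_iff cl_one_def axis_def split: if_splits)
qed

lemma lor_inner_Ad:
  fixes x :: "(real, 'n::{finite,linorder}) clifford"
  assumes "x \<in> Spin_set" shows "lor_inner (Ad x *v v) (Ad x *v w) = lor_inner v w"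
  using lor_q_add[of "Ad x *v v" "Ad x *v w"] lor_q_add[of v w]
  by (simp add: lor_q_Ad assms flip: matrix_vector_right_distrib)

section \<open>The base point and transitivity on hyperbolic space\<close>

lemma cl_vec_axis: "cl_vec (axis i 1) = cl_gen i"
proof -
  have "cl_vec (axis i 1) $ I = cl_gen i $ I" for I
  proof -
    have "cl_vec (axis i 1) $ I = (\<Sum>j\<in>UNIV. if j = i then (cl_gen i :: (real, 'a) clifford) $ I else 0)"
      unfolding cl_vec_def sum_component by (rule sum.cong) (auto simp: axis_def)
    then show ?thesis by simp
  qed
  then show ?thesis by (simp add: vec_eq_iff)
qed

lemma lor_inner_e_last: "lor_inner w e_last = - w $ last_ix"
  for w :: "('n::{finite,linorder}) lvec"
proof -
  have "lor_inner w e_last = (\<Sum>i\<in>(UNIV :: 'n set). if i = last_ix then - w $ last_ix else 0)"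
    unfolding lor_inner_def by (intro sum.cong refl) (auto simp: axis_def lor_sgn_def)
  then show ?thesis by simp
qed

lemma lor_q_inner: "lor_q v = lor_inner v v"
  by (simp add: lor_q_def lor_inner_def power2_eq_square mult.assoc)

lemma lor_q_e_last: "lor_q (e_last :: ('n::{finite,linorder}) lvec) = -1"
  by (simp add: lor_q_inner lor_inner_e_last)

text \<open>Let v be the normalized sum of x and e_{n+1}. Conjugation by e_{n+1} fixes e_{n+1}, and
  conjugation by v, being minus a reflection, carries it to x; so v e_{n+1} is the required element.
  Replacing x by t x with t in [0,1] joins it to 1 inside \<open>Spin_set\<close>.\<close>

lemma Spin_plus_transitive:
  fixes x :: "('n::{finite,linorder}) lvec"
  assumes "x \<in> hyp_space"
  obtains g where "g \<in> carrier Spin_plus" "Ad g *v e_last = x"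
proof -
  let ?l = "last_ix :: 'n"
  have x: "lor_q x = -1" "x $ ?l > 0" using assms by (auto simp: hyp_space_def)
  \<comment> \<open>This is positive for t >= 0 because x has positive last coordinate, so dividing
    by its square root puts \<open>v t\<close> on the hyperboloid q = -1.\<close>
  define q where "q t = - lor_q (t *s x + e_last)" for t
  have q: "q t = 1 + t\<^sup>2 + 2 * t * x $ ?l" for t
    using lor_q_add[of "t *s x" e_last]
    by (simp add: q_def lor_q_scale lor_q_e_last x lor_inner_e_last)
  have q_pos: "q t > 0" if "t \<ge> 0" for t
    using x that unfolding q by (intro add_pos_nonneg) auto
  define v where "v t = (1 / sqrt (q t)) *s (t *s x + e_last)" for t
  have lor_q_v: "lor_q (v t) = -1" if "t \<ge> 0" for t
  proof -
    have "lor_q (v t) = (1 / sqrt (q t))\<^sup>2 * (- q t)" unfolding v_def lor_q_scale q_def by simp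
    with q_pos[OF that] show ?thesis by (simp add: power_divide)
  qed
  define p where "p t = cl_vec (v t) \<star> cl_vec e_last" for t
  have e2: "cl_vec e_last \<star> cl_vec e_last = (cl_one :: (real, 'n) clifford)"
    by (simp add: cl_vec_square lor_q_e_last)
  \<comment> \<open>At t = 0 the vector \<open>v t\<close> is e_{n+1}, whose square is 1 because
    q(e_{n+1}) = -1.\<close>
  have p0: "p 0 = cl_one"
    by (simp add: p_def v_def q e2)
  have cont_v: "continuous_on {0..1} v"
    unfolding v_def q scalar_mult_eq_scaleR
    by (intro continuous_intros) (use q_pos[unfolded q] in \<open>force simp: less_le\<close>)
  have "linear (\<lambda>w. cl_vec w \<star> cl_vec (e_last :: 'n lvec))"
    using linear_compose[OF linear_cl_vec linear_cl_mult_left] by (simp add: o_def)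
  then have "continuous_on (v ` {0..1}) (\<lambda>w. cl_vec w \<star> cl_vec (e_last :: 'n lvec))"
    by (intro linear_continuous_on) (simp add: linear_conv_bounded_linear)
  from continuous_on_compose2[OF this cont_v order_refl] have "continuous_on {0..1} p"
    by (simp add: p_def)
  then have conn: "connected (p ` {0..1})"
    by (intro connected_continuous_image) auto
  have sub: "p ` {0..1} \<subseteq> Spin_set"
  proof
    fix y assume "y \<in> p ` {0..1}"
    then obtain t where t: "t \<ge> 0" "y = p t" by auto
    then show "y \<in> Spin_set" unfolding Spin_set_def
      by (intro CollectI exI[of _ "[v t, e_last]"])
        (simp add: p_def cl_prod_def cl_one_mult lor_q_v lor_q_e_last)
  qed
  have g: "p 1 \<in> carrier Spin_plus"
  proof (rule Spin_plusI[OF conn sub])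
    show "p 0 \<in> p ` {0..1}" "p 1 \<in> p ` {0..1}" by (rule imageI, simp)+
    show "p 0 \<in> carrier Spin_plus" by (simp add: p0 cl_one_in_Spin_plus)
  qed
  have v2: "cl_vec (v 1) \<star> cl_vec (v 1) = cl_one"
    by (simp add: cl_vec_square lor_q_v)
  have inv: "cl_inv (p 1) = cl_vec e_last \<star> cl_vec (v 1)"
  proof (rule cl_inv_eqI)
    have "p 1 \<star> (cl_vec e_last \<star> cl_vec (v 1)) = cl_vec (v 1) \<star> (cl_vec e_last \<star> cl_vec e_last) \<star> cl_vec (v 1)"
      "cl_vec e_last \<star> cl_vec (v 1) \<star> p 1 = cl_vec e_last \<star> (cl_vec (v 1) \<star> cl_vec (v 1)) \<star> cl_vec e_last"
      by (simp_all only: p_def cl_mult_assoc)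
    then show "p 1 \<star> (cl_vec e_last \<star> cl_vec (v 1)) = cl_one" "cl_vec e_last \<star> cl_vec (v 1) \<star> p 1 = cl_one"
      by (simp_all add: e2 v2 cl_one_mult)
  qed
  have "cl_vec (Ad (p 1) *v e_last)
      = cl_vec (v 1) \<star> (cl_vec e_last \<star> cl_vec e_last) \<star> cl_vec e_last \<star> cl_vec (v 1)"
    unfolding cl_vec_Ad[OF subsetD[OF Spin_plus_subset g]] inv by (simp only: p_def cl_mult_assoc)
  also have "\<dots> = cl_vec (v 1) \<star> cl_vec e_last \<star> cl_vec ((- lor_q (v 1)) *s v 1)"
    by (simp add: e2 cl_one_mult lor_q_v)
  also have "\<dots> = cl_vec ((2 * lor_inner (v 1) e_last * lor_q (v 1)) *s v 1 - e_last)"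
    by (rule cl_vec_conj) (simp add: lor_q_v)
  also have "(2 * lor_inner (v 1) e_last * lor_q (v 1)) *s v 1 - e_last = x"
  proof -
    have "2 * lor_inner (v 1) e_last * lor_q (v 1) = 2 / sqrt (q 1) * (x $ ?l + 1)"
    proof -
      have "lor_inner (v 1) e_last = - ((x $ ?l + 1) / sqrt (q 1))"
        by (simp add: lor_inner_e_last v_def add_divide_distrib)
      then show ?thesis by (simp add: lor_q_v)
    qed
    \<comment> \<open>This coincidence makes the reflection coefficient cancel both normalizing
      square roots, leaving x + e_{n+1}, from which e_{n+1} is subtracted.\<close>
    moreover have "2 * (x $ ?l + 1) = q 1" unfolding q by simp
    ultimately have "2 * lor_inner (v 1) e_last * lor_q (v 1) = q 1 / sqrt (q 1)"
      by simp
    then have "(2 * lor_inner (v 1) e_last * lor_q (v 1)) *s v 1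
        = (q 1 / sqrt (q 1) * (1 / sqrt (q 1))) *s (1 *s x + e_last)"
      by (simp only: v_def vector_smult_assoc)
    also have "q 1 / sqrt (q 1) * (1 / sqrt (q 1)) = 1"
      using q_pos[of 1] by simp
    finally show ?thesis by simp
  qed
  finally have "Ad (p 1) *v e_last = x" by (simp add: cl_vec_inject)
  with g show ?thesis by (rule that)
qed

section \<open>The stabilizer Spin(n) and its Euclidean isometries\<close>

lemma Spin_nD:
  assumes "s \<in> Spin_n"
  shows "s \<in> carrier Spin_plus" "s \<in> Spin_set" "Ad s *v e_last = e_last"
  using assms Spin_plus_subset by (auto simp: Spin_n_def)

lemma Spin_nI: "s \<in> carrier Spin_plus \<Longrightarrow> Ad s *v e_last = e_last \<Longrightarrow> s \<in> Spin_n"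
  by (simp add: Spin_n_def)

lemma cl_one_in_Spin_n: "cl_one \<in> Spin_n"
  by (simp add: Spin_n_def cl_one_in_Spin_plus Ad_one)

lemma subgroup_Spin_n: "subgroup (Spin_n :: (real, 'n::{finite,linorder}) clifford set) Spin_plus"
proof -
  interpret group "Spin_plus :: (real, 'n) clifford monoid" by (rule group_Spin_plus)
  show ?thesis
  proof (rule subgroupI)
    fix a :: "(real, 'n) clifford" assume a: "a \<in> Spin_n"
    have i: "inv\<^bsub>Spin_plus\<^esub> a \<in> carrier Spin_plus" using Spin_nD[OF a] by simp
    have "Ad (inv\<^bsub>Spin_plus\<^esub> a) *v (Ad a *v e_last) = Ad (inv\<^bsub>Spin_plus\<^esub> a \<star> a) *v e_last"
      using Spin_nD(2)[OF a] subsetD[OF Spin_plus_subset i]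
      by (simp add: Ad_mult matrix_vector_mul_assoc del: inv_closed)
    also have "\<dots> = e_last"
      using l_inv[of a] Spin_nD[OF a] by (simp add: Ad_one)
    finally show "inv\<^bsub>Spin_plus\<^esub> a \<in> Spin_n" using i Spin_nD[OF a] by (simp add: Spin_n_def)
  next
    fix a b :: "(real, 'n) clifford" assume "a \<in> Spin_n" "b \<in> Spin_n"
    note a = Spin_nD[OF this(1)] and b = Spin_nD[OF this(2)]
    have "Ad (a \<star> b) *v e_last = e_last"
      using a b by (simp add: Ad_mult flip: matrix_vector_mul_assoc)
    then show "a \<otimes>\<^bsub>Spin_plus\<^esub> b \<in> Spin_n"
      using m_closed[OF a(1) b(1)] by (simp add: Spin_n_def)
  qed (use cl_one_in_Spin_n in \<open>auto simp: Spin_n_def\<close>)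
qed

text \<open>The squared Euclidean norm is q plus twice the square of the last coordinate. The latter
  is preserved too, being up to sign the Lorentz product with the fixed vector e_{n+1}.\<close>

lemma norm_Ad_Spin_n:
  fixes s :: "(real, 'n::{finite,linorder}) clifford"
  assumes "s \<in> Spin_n"
  shows "norm (Ad s *v w) = norm w"
proof -
  have nq: "(norm w)\<^sup>2 = lor_q w + 2 * (w $ last_ix)\<^sup>2" for w :: "'n lvec"
  proof -
    have "(norm w)\<^sup>2 = (\<Sum>i\<in>UNIV. lor_sgn i * (w $ i)\<^sup>2 + (if i = last_ix then 2 * (w $ i)\<^sup>2 else 0))"
      unfolding norm_vec_def L2_set_def
      by (simp add: sum_nonneg) (intro sum.cong refl, auto simp: lor_sgn_def)
    then show ?thesis by (simp add: sum.distrib lor_q_def)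
  qed
  have "(Ad s *v w) $ last_ix = w $ last_ix"
    using lor_inner_Ad[OF Spin_nD(2)[OF assms], of w e_last] Spin_nD(3)[OF assms]
    by (simp add: lor_inner_e_last)
  then have "(norm (Ad s *v w))\<^sup>2 = (norm w)\<^sup>2"
    unfolding nq by (simp add: lor_q_Ad Spin_nD(2)[OF assms])
  then show ?thesis by simp
qed

text \<open>The matrices \<open>B j\<close> are bounded, so some subsequence \<open>B (r i)\<close>
  converges and its consecutive differences tend to 0. The isometry \<open>B (r i)\<close> carries
  \<open>B (d i) - mat 1\<close> to such a difference, where \<open>d i\<close> is the gap between
  consecutive exponents, so \<open>B (d i)\<close> tends to the identity.\<close>

lemma isometry_powers_recurrent:
  fixes B :: "nat \<Rightarrow> real ^ 'n ^ 'n"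
  assumes add: "\<And>i j. B (i + j) = B i ** B j" and iso: "\<And>j w. norm (B j *v w) = norm w"
  obtains d :: "nat \<Rightarrow> nat" where "\<And>i. d i > 0" "(\<lambda>i. B (d i)) \<longlonglongrightarrow> mat 1"
proof -
  have entry: "\<bar>M $ a $ b\<bar> \<le> norm (M *v axis b 1)" for M :: "real ^ 'n ^ 'n" and a b
    using component_le_norm_cart[of "M *v axis b 1" a] by (simp add: matrix_vector_mult_basis column_def)
  have "norm (B j) \<le> (\<Sum>a\<in>(UNIV :: 'n set). \<Sum>b\<in>(UNIV :: 'n set). 1)" for j
  proof -
    have "norm (B j) \<le> (\<Sum>a\<in>UNIV. norm (B j $ a))"
      unfolding norm_vec_def by (rule L2_set_le_sum) simp
    also have "\<dots> \<le> (\<Sum>a\<in>UNIV. \<Sum>b\<in>UNIV. \<bar>B j $ a $ b\<bar>)"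
      by (intro sum_mono norm_le_l1_cart)
    also have "\<dots> \<le> (\<Sum>a\<in>(UNIV :: 'n set). \<Sum>b\<in>(UNIV :: 'n set). 1)"
      using entry[of "B j"] by (intro sum_mono) (simp add: iso)
    finally show ?thesis .
  qed
  then have "bounded (range B)" unfolding bounded_iff by blast
  then obtain L r where r: "strict_mono r" and L: "(B \<circ> r) \<longlonglongrightarrow> L"
    using bounded_imp_convergent_subsequence[of B] by blast
  \<comment> \<open>Strict monotonicity of \<open>r\<close> keeps the gaps positive, as
    torsion-freeness will require of the exponents.\<close>
  define d where "d i = r (Suc i) - r i" for i
  have d: "d i > 0" "r (Suc i) = r i + d i" for i
    using strict_monoD[OF r, of i "Suc i"] by (auto simp: d_def)
  have D: "(\<lambda>i. B (r (Suc i)) - B (r i)) \<longlonglongrightarrow> 0"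
    using tendsto_diff[OF LIMSEQ_Suc[OF L] L] by (simp add: o_def)
  have "(\<lambda>i. B (d i) $ a $ b) \<longlonglongrightarrow> mat 1 $ a $ b" for a b
  proof (rule Lim_null_comparison[where f = "\<lambda>i. B (d i) $ a $ b - mat 1 $ a $ b", THEN LIM_zero_cancel])
    have "linear (\<lambda>M :: real ^ 'n ^ 'n. M *v axis b 1)"
      by (rule linearI) (simp_all add: matrix_vector_mult_add_rdistrib scaleR_matrix_vector_assoc)
    then have "(\<lambda>i. (B (r (Suc i)) - B (r i)) *v axis b 1) \<longlonglongrightarrow> 0 *v axis b 1"
      unfolding linear_conv_bounded_linear using D by (rule bounded_linear.tendsto)
    then show "(\<lambda>i. norm ((B (r (Suc i)) - B (r i)) *v axis b 1)) \<longlonglongrightarrow> 0"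
      by (intro tendsto_norm_zero) simp
    have "norm (B (d i) $ a $ b - mat 1 $ a $ b) \<le> norm ((B (r (Suc i)) - B (r i)) *v axis b 1)" for i
    proof -
      have "norm (B (d i) $ a $ b - mat 1 $ a $ b) \<le> norm ((B (d i) - mat 1) *v axis b 1)"
        using entry[of "B (d i) - mat 1" a b] by simp
      also have "\<dots> = norm (B (r i) *v ((B (d i) - mat 1) *v axis b 1))" by (simp add: iso)
      also have "B (r i) *v ((B (d i) - mat 1) *v axis b 1) = (B (r (Suc i)) - B (r i)) *v axis b 1"
        unfolding d(2) add
        by (simp add: matrix_vector_mult_diff_rdistrib matrix_vector_mult_diff_distrib matrix_vector_mul_assoc)
      finally show ?thesis .
    qed
    then show "\<forall>\<^sub>F i in sequentially. norm (B (d i) $ a $ b - mat 1 $ a $ b)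
        \<le> norm ((B (r (Suc i)) - B (r i)) *v axis b 1)" by simp
  qed
  then have "(\<lambda>i. B (d i)) \<longlonglongrightarrow> mat 1"
    by (intro vec_tendstoI)
  with d(1) show ?thesis by (rule that)
qed

section \<open>Spin(n) inside the subalgebra generated by the first n generators\<close>

text \<open>Multiplication by e_j toggles the membership of j in the index set, so each vector
  factor flips the parity of its cardinality.\<close>

lemma cl_prod_vec_parity:
  "cl_prod (map cl_vec vs) $ I \<noteq> 0 \<Longrightarrow> even (card I) \<longleftrightarrow> even (length vs)"
proof (induction vs arbitrary: I)
  case Nil
  then show ?case by (simp add: cl_prod_def cl_one_def axis_def split: if_splits)
next
  case (Cons v vs)
  let ?y = "cl_prod (map cl_vec vs)"
  have "(cl_vec v \<star> ?y) $ I \<noteq> 0" using Cons.prems by (simp add: cl_prod_Cons)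
  then obtain J where J: "cl_vec v $ J \<noteq> 0" "?y $ sym_diff J I \<noteq> 0"
    unfolding cl_mult_nth by (metis (no_types, lifting) sum.neutral mult_zero_left mult_zero_right)
  then obtain j where j: "J = {j}" by (auto simp: cl_vec_nth split: if_splits)
  have "even (card (sym_diff {j} I)) \<longleftrightarrow> odd (card I)"
  proof (cases "j \<in> I")
    case True
    then have "sym_diff {j} I = I - {j}" by auto
    moreover have "card I = Suc (card (I - {j}))"
      using True by (intro card.remove) auto
    ultimately show ?thesis by simp
  next
    case False
    then have "sym_diff {j} I = insert j I" by auto
    with False show ?thesis by simp
  qed
  then show ?case using Cons.IH[OF J(2)] unfolding j by simp
qed

lemma Spin_set_even: "s \<in> Spin_set \<Longrightarrow> odd (card I) \<Longrightarrow> s $ I = 0"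
  unfolding Spin_set_def using cl_prod_vec_parity by blast

text \<open>With its mirror image \<open>cl_mult_axis_nth\<close> this reads a commutation relation
  with a basis element coefficient by coefficient.\<close>

lemma cl_axis_mult_nth:
  "(axis I a \<star> y) $ sym_diff I J = cl_sign I J * a * y $ J"
proof -
  have "(axis I a \<star> y) $ sym_diff I J
      = (\<Sum>K\<in>UNIV. if K = I then cl_sign I J * a * y $ J else 0)"
    unfolding cl_mult_nth by (rule sum.cong) (auto simp: axis_def sym_diff_cancel[simplified])
  then show ?thesis by simp
qed

lemma cl_mult_axis_nth:
  "(y \<star> axis I a) $ sym_diff J I = cl_sign J I * y $ J * a"
proof -
  have eq: "sym_diff K (sym_diff J I) = I \<longleftrightarrow> K = J" for K by auto
  have "(y \<star> axis I a) $ sym_diff J I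
      = (\<Sum>K\<in>UNIV. if K = J then cl_sign J I * y $ J * a else 0)"
    unfolding cl_mult_nth
  proof (rule sum.cong[OF refl])
    fix K
    show "cl_sign K (sym_diff K (sym_diff J I)) * y $ K * axis I a $ sym_diff K (sym_diff J I)
      = (if K = J then cl_sign J I * y $ J * a else 0)"
    proof (cases "K = J")
      case True
      then have "sym_diff K (sym_diff J I) = I" by auto
      with True show ?thesis by (simp only: axis_nth if_True refl)
    next
      case False
      then have "sym_diff K (sym_diff J I) \<noteq> I" by (simp only: eq not_False_eq_True)
      with False show ?thesis by (simp only: axis_def vec_lambda_beta if_False mult_zero_right)
    qed
  qed
  then show ?thesis by simp
qed

text \<open>An even \<open>e\<^sub>J\<close> involving \<open>e\<^sub>n\<^sub>+\<^sub>1\<close> anticommutes with \<open>e\<^sub>n\<^sub>+\<^sub>1\<close>.\<close>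

lemma Spin_n_nth_eq_0:
  fixes s :: "(real, 'n::{finite,linorder}) clifford"
  assumes s: "s \<in> Spin_n" and J: "last_ix \<in> J"
  shows "s $ J = 0"
proof (cases "even (card J)")
  case False
  with Spin_set_even[OF Spin_nD(2)[OF s]] show ?thesis by blast
next
  case True
  let ?l = "last_ix :: 'n" and ?e = "axis {last_ix} 1 :: (real, 'n) clifford"
  have l: "i \<le> ?l" for i by simp
  \<comment> \<open>Moving e_{n+1} in from the left passes each smaller index at the cost of -1,
    while meeting itself costs nothing as e_{n+1}^2 = 1. An even J leaves an odd number of smaller
    indices.\<close>
  have "cl_sign {?l} J = (\<Prod>j\<in>J. if j = ?l then 1 else - 1 :: real)"
    using l by (auto simp: cl_sign_def cl_fac_def lor_sgn_def less_le intro!: prod.cong)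
  also have "\<dots> = (\<Prod>j\<in>J - {?l}. - 1)"
    using J by (subst prod.remove[of J ?l]) (auto intro!: prod.cong)
  also have "\<dots> = - 1"
  proof -
    have "odd (card (J - {?l}))"
      using True J by (metis card.remove finite even_Suc)
    then show ?thesis by simp
  qed
  finally have 1: "cl_sign {?l} J = (- 1 :: real)" .
  \<comment> \<open>From the right e_{n+1} is already in its sorted place.\<close>
  have 2: "cl_sign J {?l} = (1 :: real)"
    unfolding cl_sign_def
    using l by (auto simp add: cl_fac_def lor_sgn_def not_less simp del: Max_less_iff Max_le_iff
      intro!: prod.neutral)
  have "?e = s \<star> ?e \<star> cl_inv s"
    using cl_vec_Ad[OF Spin_nD(2)[OF s], of e_last] Spin_nD(3)[OF s]
    by (simp add: cl_vec_axis cl_gen_def)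
  then have "?e \<star> s = s \<star> ?e \<star> (cl_inv s \<star> s)"
    by (metis cl_mult_assoc)
  then have "?e \<star> s = s \<star> ?e"
    by (simp add: cl_inv_left[OF Spin_nD(2)[OF s]] cl_one_mult)
  moreover have "(?e \<star> s) $ sym_diff {?l} J = - s $ J"
    unfolding cl_axis_mult_nth 1 by simp
  moreover have "(s \<star> ?e) $ sym_diff {?l} J = s $ J"
    using cl_mult_axis_nth[of s "{?l}" 1 J] unfolding 2 by (simp only: Un_commute mult_1_left mult_1_right)
  ultimately show ?thesis by simp
qed

lemma cl_subalgebra_Cl_n: "cl_subalgebra Cl_n"
  unfolding Cl_n_def by (rule hull_in) (auto simp: cl_subalgebra_def)

lemma Cl_n_closed:
  "cl_one \<in> Cl_n"
  "x \<in> Cl_n \<Longrightarrow> y \<in> Cl_n \<Longrightarrow> x \<star> y \<in> Cl_n"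
  "x \<in> Cl_n \<Longrightarrow> c *s x \<in> Cl_n"
  using cl_subalgebra_Cl_n unfolding cl_subalgebra_def by blast+

lemma cl_subalgebra_sum:
  assumes "cl_subalgebra A" "\<And>i. i \<in> I \<Longrightarrow> f i \<in> A"
  shows "sum f I \<in> A"
proof -
  have "0 *s cl_one \<in> A" using assms(1) unfolding cl_subalgebra_def by blast
  then have "0 \<in> A" by simp
  with assms show ?thesis
    by (induction I rule: infinite_finite_induct) (auto simp: cl_subalgebra_def)
qed

lemma axis_in_Cl_n:
  fixes I :: "'n::{finite,linorder} set"
  assumes "last_ix \<notin> I"
  shows "axis I (1 :: 'a::comm_ring_1) \<in> Cl_n"
proof -
  have "cl_prod (map cl_gen xs) \<in> (Cl_n :: ('a, 'n) clifford set)" if "last_ix \<notin> set xs" for xs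
    using that
  proof (induction xs)
    case Nil
    then show ?case by (simp add: cl_prod_def Cl_n_closed)
  next
    case (Cons i xs)
    have "cl_gen i \<in> (Cl_n :: ('a, 'n) clifford set)"
      using Cons.prems unfolding Cl_n_def by (intro hull_inc) auto
    with Cons show ?case by (simp add: cl_prod_Cons Cl_n_closed)
  qed
  from this[of "sorted_list_of_set I"] assms show ?thesis by (simp add: cl_prod_gen)
qed

text \<open>Only basis products without e_{n+1} survive, by \<open>Spin_n_nth_eq_0\<close>. Since
  \<psi> is a homomorphism on \<open>Cl_n\<close>, this is what makes \<open>Delta_n\<close>
  multiplicative on Spin(n).\<close>

lemma cl_complexify_Spin_n: "s \<in> Spin_n \<Longrightarrow> cl_complexify s \<in> Cl_n"
proof -
  assume s: "s \<in> Spin_n"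
  have "cl_complexify s $ K = (\<Sum>I | last_ix \<notin> I. complex_of_real (s $ I) *s axis I 1) $ K" for K
  proof -
    have "(\<Sum>I | last_ix \<notin> I. complex_of_real (s $ I) *s axis I 1) $ K
        = (\<Sum>I | last_ix \<notin> I. if I = K then complex_of_real (s $ K) else 0)"
      unfolding sum_component by (rule sum.cong) (auto simp: axis_def)
    then show ?thesis
      using Spin_n_nth_eq_0[OF s, of K] by (simp add: cl_complexify_def)
  qed
  then have "cl_complexify s = (\<Sum>I | last_ix \<notin> I. complex_of_real (s $ I) *s axis I 1)"
    by (simp add: vec_eq_iff)
  also have "\<dots> \<in> Cl_n"
    by (intro cl_subalgebra_sum cl_subalgebra_Cl_n Cl_n_closed axis_in_Cl_n) simp
  finally show ?thesis .
qed

section \<open>Complexification and the extension to Spin(n,1)\<close>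

lemma cl_complexify_mult: "cl_complexify (x \<star> y) = cl_complexify x \<star> cl_complexify y"
proof -
  have "complex_of_real (cl_sign I J) = cl_sign I J" for I J :: "'a set"
    by (simp add: cl_sign_def cl_fac_def lor_sgn_def if_distrib[of complex_of_real] cong: if_cong)
  then show ?thesis by (simp add: vec_eq_iff cl_complexify_def cl_mult_nth)
qed

lemma cl_complexify_one: "cl_complexify cl_one = cl_one"
  by (simp add: cl_complexify_def cl_one_def axis_def vec_eq_iff)

text \<open>The fixed points of \<rho> in the algebra form a subalgebra containing e_1, ..., e_n,
  hence the hull. So \<open>Delta_n1\<close> extends \<open>Delta_n\<close> for either sign.\<close>

lemma is_rho_id:
  assumes "is_rho m \<epsilon> \<rho>" "x \<in> Cl_n"
  shows "\<rho> x = x"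
proof -
  have "Cl_n \<subseteq> {x. \<rho> x = x}"
    using assms(1) unfolding Cl_n_def is_rho_def complex_alg_hom_on_def cl_subalgebra_def
    by (intro hull_minimal) auto
  with assms(2) show ?thesis by blast
qed

section \<open>The trace in coordinates\<close>

text \<open>Any two coordinate maps differ by a matrix change of basis, under which M becomes a
  conjugate with the same trace. So the description in \<open>lin_trace\<close> has one value,
  computable in any convenient coordinates.\<close>

lemma lin_trace_eqI:
  fixes \<beta> :: "complex ^ 'k::finite \<Rightarrow> 'v"
  assumes \<beta>: "lin_coords V add smul \<beta>" and T: "\<And>v. T (\<beta> v) = \<beta> (M *v v)"
  shows "lin_trace TYPE('k) V add smul T = trace M"
proof -
  have inj: "inj \<alpha>" if "lin_coords V add smul \<alpha>" for \<alpha> :: "complex ^ 'k \<Rightarrow> 'v"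
    using that by (auto simp: lin_coords_def bij_betw_def)
  have surj: "\<alpha> (inv_into UNIV \<alpha> y) = y" if "lin_coords V add smul \<alpha>" "y \<in> V" for \<alpha> :: "complex ^ 'k \<Rightarrow> 'v" and y
    using that by (auto simp: lin_coords_def bij_betw_def f_inv_into_f)
  have inV: "\<alpha> v \<in> V" if "lin_coords V add smul \<alpha>" for \<alpha> :: "complex ^ 'k \<Rightarrow> 'v" and v
    using that by (auto simp: lin_coords_def bij_betw_def)
  have change: "\<exists>N. \<forall>v. \<alpha>' v = \<alpha> (N *v v)"
    if a: "lin_coords V add smul \<alpha>" and a': "lin_coords V add smul \<alpha>'" for \<alpha> \<alpha>' :: "complex ^ 'k \<Rightarrow> 'v"
  proof -
    define h where "h v = inv_into UNIV \<alpha> (\<alpha>' v)" for v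
    have h: "\<alpha> (h v) = \<alpha>' v" for v by (simp add: h_def surj[OF a] inV[OF a'])
    \<comment> \<open>The operations on V are known only through coordinate maps, so linearity is
      checked after applying the injective \<alpha>, where both sides become the same
      \<open>add\<close> or \<open>smul\<close> expression.\<close>
    have "Vector_Spaces.linear (*s) (*s) h"
    proof (rule Vector_Spaces.linear.intro; (rule vec.vector_space_axioms)?)
      show "module_hom (*s) (*s) h"
      proof (unfold_locales)
        show "h (v + w) = h v + h w" for v w
          using a a' by (intro injD[OF inj[OF a]]) (simp add: h lin_coords_def)
        show "h (c *s v) = c *s h v" for c v
          using a a' by (intro injD[OF inj[OF a]]) (simp add: h lin_coords_def)
      qed
    qed
    then have "\<alpha>' v = \<alpha> (matrix h *v v)" for v by (simp add: matrix_works h)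
    then show ?thesis by blast
  qed
  have tr: "trace (matrix (inv_into UNIV \<alpha> \<circ> T \<circ> \<alpha>)) = trace M" if a: "lin_coords V add smul \<alpha>" for \<alpha> :: "complex ^ 'k \<Rightarrow> 'v"
  proof -
    obtain N where N: "\<alpha> v = \<beta> (N *v v)" for v using change[OF \<beta> a] by blast
    obtain N' where N': "\<beta> v = \<alpha> (N' *v v)" for v using change[OF a \<beta>] by blast
    have "\<beta> v = \<beta> ((N ** N') *v v)" for v
      by (metis N N' matrix_vector_mul_assoc)
    then have "(N ** N') *v v = mat 1 *v v" for v
      using injD[OF inj[OF \<beta>]] by (metis matrix_vector_mul_lid)
    then have 1: "N ** N' = mat 1" by (simp add: matrix_eq)
    have "(inv_into UNIV \<alpha> \<circ> T \<circ> \<alpha>) v = (N' ** (M ** N)) *v v" for v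
    proof -
      have "T (\<alpha> v) = \<alpha> ((N' ** (M ** N)) *v v)"
        by (metis N N' T matrix_vector_mul_assoc)
      then show ?thesis by (simp add: inv_f_f[OF inj[OF a]])
    qed
    then have "inv_into UNIV \<alpha> \<circ> T \<circ> \<alpha> = (*v) (N' ** (M ** N))" by (rule ext)
    then have "trace (matrix (inv_into UNIV \<alpha> \<circ> T \<circ> \<alpha>)) = trace (N' ** (M ** N))"
      by (simp add: matrix_of_matrix_vector_mul)
    also have "\<dots> = trace (M ** N ** N')" by (rule trace_mul_sym)
    also have "\<dots> = trace M" by (simp add: 1 flip: matrix_mul_assoc)
    finally show ?thesis .
  qed
  show ?thesis
    unfolding lin_trace_def using \<beta> tr by (intro the_equality) (auto intro!: exI[of _ \<beta>])
qed

section \<open>The lifted discrete group and its free action\<close>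

text \<open>The data behind the vector space structure of the fibers: a spin representation, and a
  lift of a discrete torsion-free group, which will act freely on the cosets of Spin(n).\<close>

locale lifted_space_form =
  fixes \<psi> :: "(complex, 'n::{finite,linorder}) clifford \<Rightarrow> complex ^ 'k ^ 'k"
    and \<Gamma> :: "'n lmat set" and \<Gamma>h :: "(real, 'n) clifford set"
  assumes psi: "complex_alg_hom_on Cl_n (\<lambda>c M. mat c ** M) (**) (mat 1) \<psi>"
    and subgroup_lift: "subgroup \<Gamma>h Spin_plus"
    and inj_Ad: "inj_on Ad \<Gamma>h" and Ad_image: "Ad ` \<Gamma>h = \<Gamma>"
    and discrete: "discrete \<Gamma>" and torsion_free: "torsion_free SO_plus \<Gamma>"
begin

abbreviation G :: "(real, 'n) clifford monoid" where "G \<equiv> Spin_plus"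

abbreviation D :: "(real, 'n) clifford \<Rightarrow> complex ^ 'k ^ 'k" where "D \<equiv> Delta_n \<psi>"

abbreviation pt :: "(real, 'n) clifford \<Rightarrow> complex ^ 'k \<Rightarrow> ('n, 'k) spinor"
  where "pt \<equiv> spinor_pt \<Gamma>h D"

sublocale G: group G by (rule group_Spin_plus)

sublocale lift: subgroup \<Gamma>h G by (rule subgroup_lift)

sublocale stab: subgroup "Spin_n :: (real, 'n) clifford set" G by (rule subgroup_Spin_n)

lemma mult_Spin_plus: "x \<in> carrier G \<Longrightarrow> y \<in> carrier G \<Longrightarrow> x \<star> y \<in> carrier G"
  using G.m_closed[of x y] by simp

lemma mult_lift: "x \<in> \<Gamma>h \<Longrightarrow> y \<in> \<Gamma>h \<Longrightarrow> x \<star> y \<in> \<Gamma>h"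
  using lift.m_closed[of x y] by simp

lemma mult_Spin_n: "x \<in> Spin_n \<Longrightarrow> y \<in> Spin_n \<Longrightarrow> x \<star> y \<in> Spin_n"
  for x y :: "(real, 'n) clifford"
  using stab.m_closed[of x y] by simp

lemma one_lift: "cl_one \<in> \<Gamma>h"
  using lift.one_closed by simp

lemma Ad_mult_plus: "x \<in> carrier G \<Longrightarrow> y \<in> carrier G \<Longrightarrow> Ad (x \<star> y) = Ad x ** Ad y"
  using Spin_plus_subset by (intro Ad_mult) auto

lemma Ad_pow: "x \<in> carrier G \<Longrightarrow> Ad (x [^]\<^bsub>G\<^esub> j) = Ad x [^]\<^bsub>SO_plus\<^esub> (j :: nat)"
proof (induction j)
  case 0
  then show ?case by (simp add: Ad_one SO_plus_def nat_pow_def)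
next
  case (Suc j)
  then have "Ad (x [^]\<^bsub>G\<^esub> Suc j) = Ad (x [^]\<^bsub>G\<^esub> j) ** Ad x"
    by (simp add: Ad_mult_plus)
  with Suc show ?case by (simp add: SO_plus_def nat_pow_def)
qed

text \<open>
  The powers of \<open>Ad s\<close> are Euclidean isometries and hence accumulate at the identity, so those of
  \<open>Ad c\<close> do as well; in the discrete group \<open>\<Gamma>\<close> this makes \<open>Ad c\<close> a torsion element.
\<close>

lemma lift_free:
  assumes g: "g \<in> carrier G" and s: "s \<in> Spin_n" and c: "c \<in> \<Gamma>h" and eq: "c \<star> g = g \<star> s"
  shows "c = cl_one"
proof -
  let ?gi = "inv\<^bsub>G\<^esub> g"
  have cG: "c \<in> carrier G" and sG: "s \<in> carrier G" using c s by simp_all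
  \<comment> \<open>So c = g s g^{-1}; in this product form the induction runs on associativity
    alone.\<close>
  have pow: "c [^]\<^bsub>G\<^esub> j \<star> g = g \<star> s [^]\<^bsub>G\<^esub> j" for j :: nat
  proof (induction j)
    case 0
    then show ?case by (simp add: cl_one_mult)
  next
    case (Suc j)
    have "c [^]\<^bsub>G\<^esub> Suc j \<star> g = c [^]\<^bsub>G\<^esub> j \<star> g \<star> s"
      by (simp add: cl_mult_assoc eq)
    then show ?case unfolding Suc by (simp add: cl_mult_assoc)
  qed
  have Ad_c: "Ad (c [^]\<^bsub>G\<^esub> j) = Ad g ** Ad (s [^]\<^bsub>G\<^esub> j) ** Ad ?gi" for j :: nat
  proof -
    have "c [^]\<^bsub>G\<^esub> j = c [^]\<^bsub>G\<^esub> j \<star> (g \<star> ?gi)"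
      using G.r_inv[OF g] by (simp add: cl_one_mult)
    also have "\<dots> = g \<star> s [^]\<^bsub>G\<^esub> j \<star> ?gi"
      by (simp only: cl_mult_assoc[symmetric] pow)
    finally show ?thesis
      using g sG by (simp add: Ad_mult_plus mult_Spin_plus)
  qed
  have s_pow: "s [^]\<^bsub>G\<^esub> j \<in> Spin_n" for j :: nat
    using s cl_one_in_Spin_n by (induction j) (auto simp: mult_Spin_n)
  have "Ad (s [^]\<^bsub>G\<^esub> (i + j)) = Ad (s [^]\<^bsub>G\<^esub> i) ** Ad (s [^]\<^bsub>G\<^esub> j)" for i j :: nat
    using sG by (simp add: G.nat_pow_mult[symmetric] Ad_mult_plus)
  then obtain d :: "nat \<Rightarrow> nat"
    where d: "\<And>i. d i > 0" and lim: "(\<lambda>i. Ad (s [^]\<^bsub>G\<^esub> d i)) \<longlonglongrightarrow> mat 1"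
    using isometry_powers_recurrent[of "\<lambda>j. Ad (s [^]\<^bsub>G\<^esub> j)"] norm_Ad_Spin_n[OF s_pow] by blast
  have "linear (\<lambda>M. Ad g ** M ** Ad ?gi)"
    by (rule linearI) (simp_all add: vec_eq_iff matrix_matrix_mult_def sum_distrib_left sum_distrib_right
        sum.distrib algebra_simps)
  then have "(\<lambda>i. Ad g ** Ad (s [^]\<^bsub>G\<^esub> d i) ** Ad ?gi) \<longlonglongrightarrow> Ad g ** mat 1 ** Ad ?gi"
    unfolding linear_conv_bounded_linear using lim by (rule bounded_linear.tendsto)
  also have "Ad g ** mat 1 ** Ad ?gi = mat 1"
    using g G.r_inv[OF g] by (simp add: Ad_one flip: Ad_mult_plus)
  finally have lim_c: "(\<lambda>i. Ad (c [^]\<^bsub>G\<^esub> d i)) \<longlonglongrightarrow> mat 1"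
    by (simp only: Ad_c)
  have "mat 1 \<in> \<Gamma>" using one_lift Ad_image Ad_one by (metis imageI)
  then have "mat 1 isolated_in \<Gamma>" using discrete by (simp add: discrete_def)
  \<comment> \<open>Inside U the only element of \<Gamma> is the identity, so a power of
    \<open>Ad c\<close> that enters U is equal to the identity.\<close>
  then obtain U where U: "open U" "U \<inter> \<Gamma> = {mat 1}" by (auto simp: isolated_in_def)
  then obtain i where "Ad (c [^]\<^bsub>G\<^esub> d i) \<in> U"
    using topological_tendstoD[OF lim_c, of U] eventually_happens[of _ sequentially] by auto
  moreover have "Ad (c [^]\<^bsub>G\<^esub> d i) \<in> \<Gamma>"
  proof -
    have "c [^]\<^bsub>G\<^esub> j \<in> \<Gamma>h" for j :: nat
      using c one_lift by (induction j) (auto simp: mult_lift)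
    then show ?thesis using Ad_image by blast
  qed
  ultimately have "Ad c [^]\<^bsub>SO_plus\<^esub> d i = \<one>\<^bsub>SO_plus\<^esub>"
    using U Ad_pow[OF cG, of "d i"] by (auto simp: SO_plus_def)
  then have "Ad c = mat 1"
    using torsion_free d[of i] c Ad_image unfolding torsion_free_def by (auto simp: SO_plus_def)
  then show ?thesis
    using inj_Ad c one_lift Ad_one by (metis inj_on_def)
qed

section \<open>The spin representation of the stabilizer\<close>

lemma D_one: "D cl_one = mat 1"
  using psi by (simp add: Delta_n_def cl_complexify_one complex_alg_hom_on_def)

lemma D_mult: "s \<in> Spin_n \<Longrightarrow> t \<in> Spin_n \<Longrightarrow> D (s \<star> t) = D s ** D t"
  using psi by (simp add: Delta_n_def cl_complexify_mult cl_complexify_Spin_n complex_alg_hom_on_def)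

lemma D_inv:
  assumes "s \<in> Spin_n"
  shows "D (inv\<^bsub>G\<^esub> s) ** D s = mat 1" "D s ** D (inv\<^bsub>G\<^esub> s) = mat 1"
    "matrix_inv (D s) = D (inv\<^bsub>G\<^esub> s)"
proof -
  have i: "inv\<^bsub>G\<^esub> s \<in> Spin_n" using assms by simp
  show 1: "D (inv\<^bsub>G\<^esub> s) ** D s = mat 1" and 2: "D s ** D (inv\<^bsub>G\<^esub> s) = mat 1"
    using G.l_inv[of s] G.r_inv[of s] assms i by (simp_all add: D_one flip: D_mult)
  show "matrix_inv (D s) = D (inv\<^bsub>G\<^esub> s)"
  proof -
    \<comment> \<open>\<open>matrix_inv\<close> is a choice of some two-sided inverse; one exists by
      the two identities just shown, and cancellation then pins it down.\<close>
    have "D s ** matrix_inv (D s) = mat 1"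
      unfolding matrix_inv_def by (rule someI2) (use 1 2 in auto)
    then show ?thesis using 1 by (metis matrix_mul_assoc matrix_mul_lid matrix_mul_rid)
  qed
qed

section \<open>Points and fibers of the spinor bundle\<close>

lemma spinor_pt_eq:
  assumes "g \<in> carrier G"
  shows "pt g v = (\<lambda>s. (\<Gamma>h #>\<^bsub>G\<^esub> (g \<star> s), D (inv\<^bsub>G\<^esub> s) *v v)) ` Spin_n"
  unfolding spinor_pt_def
proof (rule image_cong[OF refl])
  fix s :: "(real, 'n) clifford" assume s: "s \<in> Spin_n"
  then have "\<Gamma>h #>\<^bsub>G\<^esub> g #>\<^bsub>G\<^esub> s = \<Gamma>h #>\<^bsub>G\<^esub> (g \<star> s)"
    using G.coset_mult_assoc[of \<Gamma>h g s] assms lift.subset by simp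
  with s show "spin_act D (\<Gamma>h #>\<^bsub>G\<^esub> g, v) s = (\<Gamma>h #>\<^bsub>G\<^esub> (g \<star> s), D (inv\<^bsub>G\<^esub> s) *v v)"
    by (simp add: spin_act_def D_inv)
qed

text \<open>The balancing relation of an associated bundle. Reparametrizing the orbit by t -> s t
  gives one inclusion; the other is the same inclusion for g s and s^{-1}.\<close>

lemma spinor_pt_mult_Spin_n:
  assumes g: "g \<in> carrier G" and s: "s \<in> Spin_n"
  shows "pt (g \<star> s) v = pt g (D s *v v)"
proof -
  have sub: "pt (g \<star> s) v \<subseteq> pt g (D s *v v)"
    if g: "g \<in> carrier G" and s: "s \<in> Spin_n" for g s :: "(real, 'n) clifford" and v
  proof
    fix p assume "p \<in> pt (g \<star> s) v"
    then obtain t where t: "t \<in> Spin_n" and p: "p = (\<Gamma>h #>\<^bsub>G\<^esub> (g \<star> s \<star> t), D (inv\<^bsub>G\<^esub> t) *v v)"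
      using g s by (auto simp: spinor_pt_eq mult_Spin_plus)
    have "inv\<^bsub>G\<^esub> (s \<star> t) \<star> s = inv\<^bsub>G\<^esub> t"
      using s t G.inv_mult_group[of s t] G.l_inv[of s] by (simp add: cl_mult_assoc cl_one_mult)
    then have "D (inv\<^bsub>G\<^esub> (s \<star> t)) *v (D s *v v) = D (inv\<^bsub>G\<^esub> t) *v v"
      using s t by (simp add: matrix_vector_mul_assoc mult_Spin_n flip: D_mult)
    then show "p \<in> pt g (D s *v v)"
      unfolding spinor_pt_eq[OF g] p using s t
      by (intro image_eqI[of _ _ "s \<star> t"]) (simp_all add: cl_mult_assoc mult_Spin_n)
  qed
  let ?si = "inv\<^bsub>G\<^esub> s"
  have si: "?si \<in> Spin_n" and gs: "g \<star> s \<in> carrier G" using g s by (simp_all add: mult_Spin_plus)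
  have "g \<star> s \<star> ?si = g" using g s G.r_inv[of s] by (simp add: cl_mult_assoc cl_one_mult)
  then have "pt g (D s *v v) \<subseteq> pt (g \<star> s) (D ?si *v (D s *v v))"
    using sub[OF gs si, of "D s *v v"] by simp
  also have "D ?si *v (D s *v v) = v"
    by (simp add: matrix_vector_mul_assoc D_inv[OF s])
  finally show ?thesis using sub[OF g s] by blast
qed

lemma lift_rcoset: "c \<in> \<Gamma>h \<Longrightarrow> g \<in> carrier G \<Longrightarrow> \<Gamma>h #>\<^bsub>G\<^esub> (c \<star> g) = \<Gamma>h #>\<^bsub>G\<^esub> g"
  using G.coset_mult_assoc[of \<Gamma>h c g] G.coset_join2[of c \<Gamma>h] lift.subset subgroup_lift by simp

lemma spinor_pt_lift_mult:
  assumes "c \<in> \<Gamma>h" "g \<in> carrier G"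
  shows "pt (c \<star> g) v = pt g v"
  using assms by (simp add: spinor_pt_def lift_rcoset)

text \<open>The representative at s = 1 of one orbit must occur in the other: its position there
  gives s, and equality of the cosets gives c. Independence of representatives below starts from
  this.\<close>

lemma spinor_pt_eqD:
  assumes "g \<in> carrier G" "g' \<in> carrier G" "pt g v = pt g' v'"
  obtains c s where "c \<in> \<Gamma>h" "s \<in> Spin_n" "g = c \<star> g' \<star> s" "v' = D s *v v"
proof -
  have "(\<Gamma>h #>\<^bsub>G\<^esub> (g \<star> cl_one), D (inv\<^bsub>G\<^esub> cl_one) *v v) \<in> pt g v"
    unfolding spinor_pt_eq[OF assms(1)] using cl_one_in_Spin_n by (rule imageI)
  then have "(\<Gamma>h #>\<^bsub>G\<^esub> g, v) \<in> pt g' v'"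
    using G.inv_one assms(3) by (simp add: cl_one_mult D_one)
  then obtain s where s: "s \<in> Spin_n" "\<Gamma>h #>\<^bsub>G\<^esub> g = \<Gamma>h #>\<^bsub>G\<^esub> (g' \<star> s)" "v = D (inv\<^bsub>G\<^esub> s) *v v'"
    unfolding spinor_pt_eq[OF assms(2)] by auto
  have "g \<in> \<Gamma>h #>\<^bsub>G\<^esub> g"
    using one_lift by (auto simp: r_coset_def cl_one_mult intro!: bexI[of _ cl_one])
  then obtain c where c: "c \<in> \<Gamma>h" "g = c \<star> g' \<star> s"
    unfolding s(2) by (auto simp: r_coset_def cl_mult_assoc)
  have "v' = D s *v v" unfolding s(3) by (simp add: matrix_vector_mul_assoc D_inv[OF s(1)])
  with c s(1) show ?thesis by (intro that)
qed

text \<open>Freeness enters here: g = c g s means c^{-1} g = g s, so \<open>lift_free\<close> yields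
  c = 1 and then s = 1. Hence a fiber is a full copy of C^k and not a proper quotient.\<close>

lemma spinor_pt_inject:
  assumes g: "g \<in> carrier G"
  shows "pt g v = pt g w \<longleftrightarrow> v = w"
proof
  assume "pt g v = pt g w"
  then obtain c s where *: "c \<in> \<Gamma>h" "s \<in> Spin_n" "g = c \<star> g \<star> s" "w = D s *v v"
    using spinor_pt_eqD[OF g g] by metis
  have "inv\<^bsub>G\<^esub> c \<star> g = inv\<^bsub>G\<^esub> c \<star> (c \<star> g \<star> s)" using *(3) by simp
  also have "\<dots> = inv\<^bsub>G\<^esub> c \<star> c \<star> g \<star> s" by (simp add: cl_mult_assoc)
  also have "\<dots> = g \<star> s" using * G.l_inv[of c] by (simp add: cl_one_mult)
  finally have eq: "inv\<^bsub>G\<^esub> c \<star> g = g \<star> s" .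
  then have "inv\<^bsub>G\<^esub> c = cl_one" using *(1) by (intro lift_free[OF g *(2)]) simp_all
  then have "inv\<^bsub>G\<^esub> g \<star> g \<star> s = inv\<^bsub>G\<^esub> g \<star> g"
    using eq by (simp add: cl_one_mult cl_mult_assoc)
  then have "s = cl_one" using G.l_inv[OF g] by (simp add: cl_one_mult)
  then show "v = w" using * by (simp add: D_one)
qed simp

lemma orb_lift:
  assumes "c \<in> \<Gamma>h"
  shows "orb \<Gamma> (Ad c *v y) = orb \<Gamma> y"
proof -
  have orb: "orb \<Gamma> y = (\<lambda>b. Ad b *v y) ` \<Gamma>h" for y
    by (simp add: orb_def Ad_image[symmetric] image_image)
  have sub: "orb \<Gamma> (Ad c *v y) \<subseteq> orb \<Gamma> y" if "c \<in> \<Gamma>h" for c y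
  proof
    fix z assume "z \<in> orb \<Gamma> (Ad c *v y)"
    then obtain b where b: "b \<in> \<Gamma>h" "z = Ad b *v (Ad c *v y)"
      by (auto simp: orb)
    then have "z = Ad (b \<star> c) *v y"
      using that by (simp add: matrix_vector_mul_assoc Ad_mult_plus)
    with b(1) that show "z \<in> orb \<Gamma> y" by (auto simp: orb mult_lift)
  qed
  have "Ad (inv\<^bsub>G\<^esub> c) *v (Ad c *v y) = y"
    using assms G.l_inv[of c] by (simp add: matrix_vector_mul_assoc Ad_one flip: Ad_mult_plus)
  then have "orb \<Gamma> y \<subseteq> orb \<Gamma> (Ad c *v y)"
    using sub[of "inv\<^bsub>G\<^esub> c" "Ad c *v y"] assms by simp
  with sub[OF assms] show ?thesis by blast
qed

lemma spinor_proj_pt: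
  assumes g: "g \<in> carrier G"
  shows "spinor_proj \<Gamma> \<Gamma>h D (pt g v) = orb \<Gamma> (Ad g *v e_last)"
  unfolding spinor_proj_def
proof (rule the_equality)
  fix b assume "\<exists>g' v'. g' \<in> carrier G \<and> pt g v = pt g' v' \<and> b = orb \<Gamma> (Ad g' *v e_last)"
  then obtain g' v' where g': "g' \<in> carrier G" "pt g v = pt g' v'" "b = orb \<Gamma> (Ad g' *v e_last)"
    by blast
  obtain c s where cs: "c \<in> \<Gamma>h" "s \<in> Spin_n" "g = c \<star> g' \<star> s"
    using spinor_pt_eqD[OF g g'(1,2)] by metis
  have "Ad g *v e_last = Ad c *v (Ad g' *v (Ad s *v e_last))"
    unfolding cs(3) using cs(1,2) g'(1) by (simp add: Ad_mult_plus mult_Spin_plus flip: matrix_vector_mul_assoc)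
  also have "\<dots> = Ad c *v (Ad g' *v e_last)" using Spin_nD(3)[OF cs(2)] by simp
  finally show "b = orb \<Gamma> (Ad g *v e_last)" by (simp add: g'(3) orb_lift[OF cs(1)])
qed (use g in blast)

text \<open>Passing from g = c g' s to g' multiplies coordinates by \<open>D s\<close>. Injectivity
  over g' forces this same matrix on the second summand, so linearity of \<open>D s\<close> makes
  the sum independent of the representative.\<close>

lemma spinor_add_pt:
  assumes g: "g \<in> carrier G"
  shows "spinor_add \<Gamma>h D (pt g v) (pt g w) = pt g (v + w)"
  unfolding spinor_add_def
proof (rule the_equality)
  fix R assume "\<exists>g' v' w'. g' \<in> carrier G \<and> pt g v = pt g' v' \<and> pt g w = pt g' w' \<and> R = pt g' (v' + w')"
  then obtain g' v' w' where g': "g' \<in> carrier G" and v': "pt g v = pt g' v'" and w': "pt g w = pt g' w'"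
    and R: "R = pt g' (v' + w')" by blast
  obtain c s where cs: "c \<in> \<Gamma>h" "s \<in> Spin_n" "g = c \<star> g' \<star> s" "v' = D s *v v"
    using spinor_pt_eqD[OF g g' v'] by metis
  have pt: "pt g u = pt g' (D s *v u)" for u
    unfolding cs(3) cl_mult_assoc using cs(1,2) g'
    by (simp add: spinor_pt_lift_mult spinor_pt_mult_Spin_n mult_Spin_plus)
  have "w' = D s *v w" using w' unfolding pt spinor_pt_inject[OF g'] by simp
  then show "R = pt g (v + w)" unfolding R pt cs(4) by (simp add: matrix_vector_right_distrib)
qed (use g in blast)

lemma spinor_scale_pt:
  assumes g: "g \<in> carrier G"
  shows "spinor_scale \<Gamma>h D a (pt g v) = pt g (a *s v)"
  unfolding spinor_scale_def
proof (rule the_equality)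
  fix R assume "\<exists>g' v'. g' \<in> carrier G \<and> pt g v = pt g' v' \<and> R = pt g' (a *s v')"
  then obtain g' v' where g': "g' \<in> carrier G" and v': "pt g v = pt g' v'" and R: "R = pt g' (a *s v')"
    by blast
  obtain c s where cs: "c \<in> \<Gamma>h" "s \<in> Spin_n" "g = c \<star> g' \<star> s" "v' = D s *v v"
    using spinor_pt_eqD[OF g g' v'] by metis
  have "pt g (a *s v) = pt g' (D s *v (a *s v))"
    unfolding cs(3) cl_mult_assoc using cs(1,2) g'
    by (simp add: spinor_pt_lift_mult spinor_pt_mult_Spin_n mult_Spin_plus)
  then show "R = pt g (a *s v)" unfolding R cs(4) by (simp add: vec.scale)
qed (use g in blast)

text \<open>For g = c g' s, moving c across fh turns it into another element of the lift, which is
  absorbed on the left, while s is untouched on the right.\<close>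

lemma spinor_aut_pt:
  assumes fh: "fh \<in> carrier G" and norm: "\<And>c. c \<in> \<Gamma>h \<Longrightarrow> \<exists>c'\<in>\<Gamma>h. fh \<star> c = c' \<star> fh"
    and g: "g \<in> carrier G"
  shows "spinor_aut \<Gamma>h D fh (pt g v) = pt (fh \<star> g) v"
  unfolding spinor_aut_def
proof (rule the_equality)
  fix Q assume "\<exists>g' v'. g' \<in> carrier G \<and> pt g v = pt g' v' \<and> Q = pt (fh \<star> g') v'"
  then obtain g' v' where g': "g' \<in> carrier G" and v': "pt g v = pt g' v'" and Q: "Q = pt (fh \<star> g') v'"
    by blast
  obtain c s where cs: "c \<in> \<Gamma>h" "s \<in> Spin_n" "g = c \<star> g' \<star> s" "v' = D s *v v"
    using spinor_pt_eqD[OF g g' v'] by metis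
  obtain c' where c': "c' \<in> \<Gamma>h" "fh \<star> c = c' \<star> fh" using norm[OF cs(1)] by blast
  have "fh \<star> g = (fh \<star> c) \<star> g' \<star> s" by (simp add: cs(3) cl_mult_assoc)
  also have "\<dots> = c' \<star> ((fh \<star> g') \<star> s)" by (simp add: c' cl_mult_assoc)
  finally have "pt (fh \<star> g) v = pt ((fh \<star> g') \<star> s) v"
    using c' cs(2) fh g' by (simp add: spinor_pt_lift_mult mult_Spin_plus)
  also have "\<dots> = pt (fh \<star> g') (D s *v v)"
    using cs(2) fh g' by (simp add: spinor_pt_mult_Spin_n mult_Spin_plus)
  finally show "Q = pt (fh \<star> g) v" by (simp add: Q cs(4))
qed (use g in blast)

text \<open>If g' lies over the same orbit as g, some c in the lift matches the two base points
  exactly. Then s = (c g)^{-1} g' fixes e_{n+1}, and g' = c g s can be rewritten over g.\<close>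

lemma spinor_fiber_eq:
  assumes g: "g \<in> carrier G"
  shows "spinor_fiber \<Gamma> \<Gamma>h D (orb \<Gamma> (Ad g *v e_last)) = range (pt g)"
proof
  show "range (pt g) \<subseteq> spinor_fiber \<Gamma> \<Gamma>h D (orb \<Gamma> (Ad g *v e_last))"
    using g by (auto simp: spinor_fiber_def spinor_bundle_def spinor_proj_pt)
  show "spinor_fiber \<Gamma> \<Gamma>h D (orb \<Gamma> (Ad g *v e_last)) \<subseteq> range (pt g)"
  proof
    fix P assume "P \<in> spinor_fiber \<Gamma> \<Gamma>h D (orb \<Gamma> (Ad g *v e_last))"
    then obtain g' v where g': "g' \<in> carrier G" and P: "P = pt g' v"
      and o: "orb \<Gamma> (Ad g' *v e_last) = orb \<Gamma> (Ad g *v e_last)"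
      by (auto simp: spinor_fiber_def spinor_bundle_def spinor_proj_pt)
    have "Ad g' *v e_last \<in> orb \<Gamma> (Ad g' *v e_last)"
    proof -
      have "mat 1 \<in> \<Gamma>" using one_lift Ad_image Ad_one by (metis imageI)
      then show ?thesis unfolding orb_def by (rule rev_image_eqI) simp
    qed
    then obtain c where c: "c \<in> \<Gamma>h" "Ad g' *v e_last = Ad c *v (Ad g *v e_last)"
      unfolding o by (auto simp: orb_def Ad_image[symmetric])
    define s where "s = inv\<^bsub>G\<^esub> (c \<star> g) \<star> g'"
    have cg: "c \<star> g \<in> carrier G" using c g by (simp add: mult_Spin_plus)
    have "Ad s *v e_last = Ad (inv\<^bsub>G\<^esub> (c \<star> g)) *v (Ad (c \<star> g) *v e_last)"
      using cg g g' c by (simp add: s_def Ad_mult_plus c(2) flip: matrix_vector_mul_assoc)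
    also have "\<dots> = e_last"
      using cg G.l_inv[OF cg] by (simp add: matrix_vector_mul_assoc Ad_one flip: Ad_mult_plus)
    finally have s: "s \<in> Spin_n"
      using cg g' by (intro Spin_nI) (simp_all add: s_def mult_Spin_plus)
    have "g' = (c \<star> g) \<star> inv\<^bsub>G\<^esub> (c \<star> g) \<star> g'"
      using G.r_inv[OF cg] by (simp add: cl_one_mult)
    then have "g' = c \<star> (g \<star> s)" by (simp add: s_def cl_mult_assoc)
    then have "P = pt g (D s *v v)"
      using s c g by (simp add: P spinor_pt_lift_mult spinor_pt_mult_Spin_n mult_Spin_plus)
    then show "P \<in> range (pt g)" by blast
  qed
qed

end

section \<open>The trace formula\<close>

theorem theorem7p2:
  fixes n m :: nat
    and \<psi> :: "(complex, 'n::{finite,linorder}) clifford \<Rightarrow> complex ^ 'k ^ 'k"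
    and \<rho> :: "(complex, 'n) clifford \<Rightarrow> (complex, 'n) clifford"
    and \<epsilon> :: complex
    and \<Gamma> :: "'n lmat set"
    and \<Gamma>h :: "(real, 'n) clifford set"
    and \<phi> :: "'n lvec set \<Rightarrow> 'n lvec set"
    and f \<gamma> :: "'n lmat"
    and fh \<gamma>h :: "(real, 'n) clifford"
    and x :: "'n lvec"
  assumes "n = 2 * m" and "n > 0" and "CARD('n) = n + 1" and "CARD('k) = 2 ^ m"
    and "is_psi \<psi>" and "\<epsilon> = 1 \<or> \<epsilon> = -1" and "is_rho m \<epsilon> \<rho>"
    and "subgroup \<Gamma> SO_plus" and "discrete \<Gamma>" and "torsion_free SO_plus \<Gamma>"
    and "orientation_preserving_isometry \<Gamma> \<phi>"
    and "f \<in> carrier SO_plus"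
    and "f <#\<^bsub>SO_plus\<^esub> \<Gamma> #>\<^bsub>SO_plus\<^esub> inv\<^bsub>SO_plus\<^esub> f = \<Gamma>"
    and "\<And>y. y \<in> hyp_space \<Longrightarrow> \<phi> (orb \<Gamma> y) = orb \<Gamma> (f *v y)"
    and "subgroup \<Gamma>h Spin_plus"
    and "Ad \<in> iso (Spin_plus\<lparr>carrier := \<Gamma>h\<rparr>) (SO_plus\<lparr>carrier := \<Gamma>\<rparr>)"
    and "fh \<in> carrier Spin_plus" and "Ad fh = f"
    and "fh <#\<^bsub>Spin_plus\<^esub> \<Gamma>h #>\<^bsub>Spin_plus\<^esub> inv\<^bsub>Spin_plus\<^esub> fh = \<Gamma>h"
    and "x \<in> hyp_space" and "\<phi> (orb \<Gamma> x) = orb \<Gamma> x"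
    and "\<gamma> \<in> \<Gamma>" and "\<gamma> *v (f *v x) = x"
    and "\<gamma>h \<in> \<Gamma>h" and "Ad \<gamma>h = \<gamma>"
  shows "lin_trace TYPE('k) (spinor_fiber \<Gamma> \<Gamma>h (Delta_n \<psi>) (orb \<Gamma> x))
           (spinor_add \<Gamma>h (Delta_n \<psi>)) (spinor_scale \<Gamma>h (Delta_n \<psi>))
           (restrict (spinor_aut \<Gamma>h (Delta_n \<psi>) fh) (spinor_fiber \<Gamma> \<Gamma>h (Delta_n \<psi>) (orb \<Gamma> x)))
         = trace (Delta_n1 \<psi> \<rho> (\<gamma>h \<star> fh))"
proof -
  interpret lifted_space_form \<psi> \<Gamma> \<Gamma>h
  proof (rule lifted_space_form.intro)
    show "complex_alg_hom_on Cl_n (\<lambda>c M. mat c ** M) (**) (mat 1) \<psi>"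
      using \<open>is_psi \<psi>\<close> by (simp add: is_psi_def)
    have "bij_betw Ad \<Gamma>h \<Gamma>" using assms(16) by (simp add: iso_def)
    then show "inj_on Ad \<Gamma>h" "Ad ` \<Gamma>h = \<Gamma>" by (simp_all add: bij_betw_def)
  qed fact+
  note fh = \<open>fh \<in> carrier Spin_plus\<close>
  have norm: "\<exists>c'\<in>\<Gamma>h. fh \<star> c = c' \<star> fh" if "c \<in> \<Gamma>h" for c
  proof -
    \<comment> \<open>The witness is fh c fh^{-1}, placed in \<Gamma>h by the normalization
      hypothesis.\<close>
    have "fh \<star> c \<star> inv\<^bsub>Spin_plus\<^esub> fh \<in> fh <#\<^bsub>Spin_plus\<^esub> \<Gamma>h #>\<^bsub>Spin_plus\<^esub> inv\<^bsub>Spin_plus\<^esub> fh"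
      using that by (auto simp: l_coset_def r_coset_def)
    moreover have "fh \<star> c \<star> inv\<^bsub>Spin_plus\<^esub> fh \<star> fh = fh \<star> c"
      using G.l_inv[OF fh] by (simp add: cl_mult_assoc cl_one_mult)
    ultimately show ?thesis using assms(19) by metis
  qed
  obtain g where g: "g \<in> carrier Spin_plus" and gx: "Ad g *v e_last = x"
    using Spin_plus_transitive[OF \<open>x \<in> hyp_space\<close>] .
  let ?gi = "inv\<^bsub>Spin_plus\<^esub> g"
  define h where "h = \<gamma>h \<star> fh"
  have h: "h \<in> carrier Spin_plus" using fh \<open>\<gamma>h \<in> \<Gamma>h\<close> by (simp add: h_def mult_Spin_plus)
  define s where "s = ?gi \<star> h \<star> g"
  have gi: "?gi \<star> g = cl_one" "g \<star> ?gi = cl_one" using G.l_inv[OF g] G.r_inv[OF g] by simp_all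
  have "Ad h *v x = x"
    using assms(18,23,25) fh \<open>\<gamma>h \<in> \<Gamma>h\<close> by (simp add: h_def Ad_mult_plus flip: matrix_vector_mul_assoc)
  then have "Ad s *v e_last = Ad ?gi *v (Ad g *v e_last)"
    using g h gx by (simp add: s_def Ad_mult_plus mult_Spin_plus flip: matrix_vector_mul_assoc)
  also have "\<dots> = e_last"
    using g gi by (simp add: matrix_vector_mul_assoc Ad_one flip: Ad_mult_plus)
  finally have s: "s \<in> Spin_n" using g h by (intro Spin_nI) (simp_all add: s_def mult_Spin_plus)
  have gs: "g \<star> s = h \<star> g"
  proof -
    have "g \<star> s = (g \<star> ?gi) \<star> (h \<star> g)" by (simp only: s_def cl_mult_assoc)
    then show ?thesis by (simp add: gi cl_one_mult)
  qed
  have fiber: "spinor_fiber \<Gamma> \<Gamma>h D (orb \<Gamma> x) = range (pt g)"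
    using spinor_fiber_eq[OF g] gx by simp
  have coords: "lin_coords (spinor_fiber \<Gamma> \<Gamma>h D (orb \<Gamma> x)) (spinor_add \<Gamma>h D) (spinor_scale \<Gamma>h D) (pt g)"
    unfolding lin_coords_def fiber using g
    by (auto simp: bij_betw_def inj_on_def spinor_pt_inject spinor_add_pt spinor_scale_pt)
  have "spinor_aut \<Gamma>h D fh (pt g v) = pt g (D s *v v)" for v
  proof -
    have "spinor_aut \<Gamma>h D fh (pt g v) = pt (fh \<star> g) v"
      using fh norm g by (rule spinor_aut_pt)
    \<comment> \<open>Inserting \<open>\<gamma>h\<close> on the left does not change the point, but
      turns fh g into h g = g s, which is again expressed over g.\<close>
    also have "\<dots> = pt (\<gamma>h \<star> (fh \<star> g)) v"
      using \<open>\<gamma>h \<in> \<Gamma>h\<close> fh g by (simp add: spinor_pt_lift_mult mult_Spin_plus)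
    also have "\<dots> = pt (g \<star> s) v" by (simp add: gs h_def cl_mult_assoc)
    also have "\<dots> = pt g (D s *v v)" using g s by (rule spinor_pt_mult_Spin_n)
    finally show ?thesis .
  qed
  then have "lin_trace TYPE('k) (spinor_fiber \<Gamma> \<Gamma>h D (orb \<Gamma> x)) (spinor_add \<Gamma>h D) (spinor_scale \<Gamma>h D)
      (restrict (spinor_aut \<Gamma>h D fh) (spinor_fiber \<Gamma> \<Gamma>h D (orb \<Gamma> x))) = trace (D s)"
    by (intro lin_trace_eqI[OF coords]) (simp add: fiber)
  \<comment> \<open>The factors g and h need not lie in Spin(n), so s can be taken apart only after
    passing to \<open>Delta_n1\<close>.\<close>
  also have "D s = Delta_n1 \<psi> \<rho> s"
    using is_rho_id[OF \<open>is_rho m \<epsilon> \<rho>\<close> cl_complexify_Spin_n[OF s]]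
    by (simp add: Delta_n_def Delta_n1_def)
  also have "trace \<dots> = trace (Delta_n1 \<psi> \<rho> h)"
  proof -
    \<comment> \<open>\<psi> is assumed multiplicative on \<open>Cl_n\<close>; as \<rho> takes its
      values there, the composite is multiplicative on the whole algebra.\<close>
    have \<rho>: "\<rho> y \<in> Cl_n" "\<rho> (y \<star> z) = \<rho> y \<star> \<rho> z" "\<rho> cl_one = cl_one" for y z
      using \<open>is_rho m \<epsilon> \<rho>\<close> by (auto simp: is_rho_def complex_alg_hom_on_def)
    have mult: "Delta_n1 \<psi> \<rho> (y \<star> z) = Delta_n1 \<psi> \<rho> y ** Delta_n1 \<psi> \<rho> z" for y z
      using psi \<rho> by (simp add: Delta_n1_def cl_complexify_mult complex_alg_hom_on_def)
    have "trace (Delta_n1 \<psi> \<rho> s) = trace (Delta_n1 \<psi> \<rho> ?gi ** Delta_n1 \<psi> \<rho> (h \<star> g))"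
      by (simp add: s_def mult cl_mult_assoc)
    also have "\<dots> = trace (Delta_n1 \<psi> \<rho> (h \<star> g) ** Delta_n1 \<psi> \<rho> ?gi)" by (rule trace_mul_sym)
    also have "\<dots> = trace (Delta_n1 \<psi> \<rho> h)"
      by (simp add: cl_mult_assoc gi cl_one_mult flip: mult)
    finally show ?thesis .
  qed
  finally show ?thesis by (simp only: h_def)
qed

end
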